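(* Fix positive weights $w=(w_1,\dots,w_N)$, with associated clusters $C_1,\dots,C_K$ from the hierarchical minimax decomposition. Under the JLW policy with weights $w$ the weighted random walk $w\xi(t)=(w_1\xi_1(t),\dots,w_N\xi_N(t))$ is recurrent in shape on each bonded sub-cluster $C\subseteq C_k$, $k=1,\dots,K$.
   Context: Model. $C_0=\{1,\dots,N\}$ is a finite set of stations; station $j$ has service rate $\mu_j>0$. There is a finite collection of non-empty sets (neighbourhoods) $S_i\subseteq C_0$ with arrival rates $\lambda_i\ge 0$; $\mathcal{N}(C_0)$ denotes the collection of neighbourhoods with $\lambda_i>0$, and one writes $i\in\mathcal{N}(C_0)$ for $S_i\in\mathcal{N}(C_0)$. The bipartite graph with nodes $\mathcal{N}(C_0)\cup C_0$ and edges $\{(S_i,j):j\in S_i\}$ is assumed connected. A cluster is any non-empty set of stations. JLW policy and random walk. The JLW (join the least weighted queue) policy with positive weights $w$ routes an arrival at $S_i$ in state $x$ to station $j$ with probability $\pi(x,i)_j=1/|\mathcal{B}_i(x)|$ if $j\in\mathcal{B}_i(x)$ and $0$ otherwise, where $\mathcal{B}_i(x)=\{j\in S_i: w_jx_j=\min_{l\in S_i}w_lx_l\}$. Under this policy $\xi(t)$ is the continuous-time Markov chain on $\mathbb{Z}^N$ (no reflection at $0$) with jumps $x\mapsto x+e_j$ at rate $\sum_{i\in\mathcal{N}(C_0):\,j\in S_i}\lambda_i\pi(x,i)_j$ and $x\mapsto x-e_j$ at rate $\mu_j$, for every $x\in\mathbb{Z}^N$ and $j\in C_0$, where $e_j$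 is the $j$-th unit vector. Drifts and clusters. A static policy $\pi$ assigns to each $i\in\mathcal{N}(C_0)$ a probability vector $\pi(i)=(\pi(i)_j)_{j\in C_0}$ with $\pi(i)_j=0$ for $j\notin S_i$; $\Pi_{\mathrm{stat}}$ is the set of static policies, and $V(j;\pi)=\sum_{i\in\mathcal{N}(C_0)}\lambda_i\pi(i)_j-\mu_j$. The hierarchical minimax decomposition for weights $w$ is defined recursively: $\Pi_0=\Pi_{\mathrm{stat}}$, $D_1=C_0$; for $k\ge1$ with $D_k\ne\emptyset$, $V_k=\min_{\pi\in\Pi_{k-1}}\max_{j\in D_k}w_jV(j;\pi)$; $C_k\subseteq D_k$ is the (unique) set of minimal cardinality among the sets $\{j\in D_k:w_jV(j;\pi)=V_k\}$, with $\pi$ ranging over the policies in $\Pi_{k-1}$ attaining this minimum; $\Pi_k=\{\pi\in\Pi_{k-1}:\max_{j\in C_k}w_jV(j;\pi)=V_k\}$; $D_{k+1}=D_k\setminus C_k$. The procedure stops at the stage $K\le N$ with $D_{K+1}=\emptyset$, so $C_1,\dots,C_K$ partition $C_0$. Bonded. For $\pi\in\Pi_{\mathrm{stat}}$ let $G(\pi)$ be the bipartite graph with nodes $\mathcal{N}(C_0)\cup C_0$ and edges $\{(S_i,j):\pi(i)_j>0\}$. A cluster $C\subseteq C_k$ is bonded if there exists a policy $\pi\in\Pi_k$ such that for every pair $j,m\in C$ there is a path in $G(\pi)$ from $j$ to $m$. Recurrence in shape. A process $Y(t)=(Y_1(t),\dots,Y_N(t))$ is recurrent in shape on $C\subseteq\{1,\dots,N\}$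 if, for any $j_0\in C$, the process $(Y_j(t)-Y_{j_0}(t):j\in C)$ is recurrent. Here recurrent means: there is a bounded set which, from any initial state, the process visits at arbitrarily large times almost surely. *)

theory Defs
  imports "HOL-Probability.Probability"
begin

text \<open>
  The stations are the elements of a finite type \<open>'n\<close>, so \<open>C\<^sub>0 = UNIV\<close> and \<open>N = CARD('n)\<close>.
  The finite collection of neighbourhoods is a family \<open>S :: 'i \<Rightarrow> 'n set\<close> over a finite index type,
  with arrival rates \<open>lam :: 'i \<Rightarrow> real\<close>. Repeated sets are allowed, and indices of rate \<open>0\<close> play no
  role (so an empty collection is covered by \<open>lam = (\<lambda>i. 0)\<close>).
\<close>

definition active :: "('i \<Rightarrow> real) \<Rightarrow> 'i set" where
  "active lam = {i. lam i > 0}"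

text \<open>
  Bipartite graphs between indices and stations are given as symmetric relations on the sum type;
  two nodes are joined by a path iff they are related by the reflexive transitive closure.
\<close>

definition bipartite :: "('i \<Rightarrow> 'n \<Rightarrow> bool) \<Rightarrow> ('i + 'n) rel" where
  "bipartite E = {(Inl i, Inr j) | i j. E i j} \<union> {(Inr j, Inl i) | i j. E i j}"

definition connected_network :: "('i \<Rightarrow> 'n set) \<Rightarrow> ('i \<Rightarrow> real) \<Rightarrow> bool" where
  "connected_network S lam \<longleftrightarrow>
     (\<forall>u \<in> Inl ` active lam \<union> range Inr. \<forall>v \<in> Inl ` active lam \<union> range Inr.
        (u, v) \<in> (bipartite (\<lambda>i j. i \<in> active lam \<and> j \<in> S i))\<^sup>*)"


subsection \<open>Static policies and the hierarchical minimax decomposition\<close>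

text \<open>The values of a policy at inactive indices are unconstrained and never used.\<close>

type_synonym ('i, 'n) policy = "'i \<Rightarrow> 'n \<Rightarrow> real"

definition static_policies :: "('i \<Rightarrow> 'n::finite set) \<Rightarrow> ('i \<Rightarrow> real) \<Rightarrow> ('i, 'n) policy set" where
  "static_policies S lam =
     {\<pi>. \<forall>i \<in> active lam. (\<forall>j. 0 \<le> \<pi> i j) \<and> (\<Sum>j\<in>UNIV. \<pi> i j) = 1 \<and> (\<forall>j. j \<notin> S i \<longrightarrow> \<pi> i j = 0)}"

definition drift :: "('i \<Rightarrow> real) \<Rightarrow> ('n \<Rightarrow> real) \<Rightarrow> ('i, 'n) policy \<Rightarrow> 'n \<Rightarrow> real" where
  "drift lam mu \<pi> j = (\<Sum>i\<in>active lam. lam i * \<pi> i j) - mu j"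

definition max_drift ::
  "('i \<Rightarrow> real) \<Rightarrow> ('n \<Rightarrow> real) \<Rightarrow> ('n \<Rightarrow> real) \<Rightarrow> 'n set \<Rightarrow> ('i, 'n) policy \<Rightarrow> real" where
  "max_drift lam mu w D \<pi> = Max ((\<lambda>j. w j * drift lam mu \<pi> j) ` D)"

definition minimax_value ::
  "('i \<Rightarrow> real) \<Rightarrow> ('n \<Rightarrow> real) \<Rightarrow> ('n \<Rightarrow> real) \<Rightarrow> ('i, 'n) policy set \<Rightarrow> 'n set \<Rightarrow> real" where
  "minimax_value lam mu w Q D = (LEAST v. v \<in> max_drift lam mu w D ` Q)"

definition minimax_cluster ::
  "('i \<Rightarrow> real) \<Rightarrow> ('n \<Rightarrow> real) \<Rightarrow> ('n \<Rightarrow> real) \<Rightarrow> ('i, 'n) policy set \<Rightarrow> 'n set \<Rightarrow> 'n set" where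
  "minimax_cluster lam mu w Q D =
     arg_min card (\<lambda>C. \<exists>\<pi>\<in>Q. max_drift lam mu w D \<pi> = minimax_value lam mu w Q D \<and>
       C = {j \<in> D. w j * drift lam mu \<pi> j = minimax_value lam mu w Q D})"

text \<open>\<open>stage S lam mu w k\<close> is the pair \<open>(\<Pi>\<^sub>k, D\<^sub>k\<^sub>+\<^sub>1)\<close>.\<close>

primrec stage ::
  "('i \<Rightarrow> 'n::finite set) \<Rightarrow> ('i \<Rightarrow> real) \<Rightarrow> ('n \<Rightarrow> real) \<Rightarrow> ('n \<Rightarrow> real) \<Rightarrow> nat
     \<Rightarrow> ('i, 'n) policy set \<times> 'n set" where
  "stage S lam mu w 0 = (static_policies S lam, UNIV)"
| "stage S lam mu w (Suc k) =
     (let Q = fst (stage S lam mu w k); D = snd (stage S lam mu w k);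
          C = minimax_cluster lam mu w Q D
      in if D = {} then (Q, D)
         else ({\<pi> \<in> Q. max_drift lam mu w C \<pi> = minimax_value lam mu w Q D}, D - C))"

definition stage_policies ::
  "('i \<Rightarrow> 'n::finite set) \<Rightarrow> ('i \<Rightarrow> real) \<Rightarrow> ('n \<Rightarrow> real) \<Rightarrow> ('n \<Rightarrow> real) \<Rightarrow> nat \<Rightarrow> ('i, 'n) policy set" where
  "stage_policies S lam mu w k = fst (stage S lam mu w k)"

text \<open>The following is meant for \<open>1 \<le> k \<le> num_stages\<close>, where it is the cluster \<open>C\<^sub>k\<close>.\<close>

definition stage_cluster ::
  "('i \<Rightarrow> 'n::finite set) \<Rightarrow> ('i \<Rightarrow> real) \<Rightarrow> ('n \<Rightarrow> real) \<Rightarrow> ('n \<Rightarrow> real) \<Rightarrow> nat \<Rightarrow> 'n set" where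
  "stage_cluster S lam mu w k =
     minimax_cluster lam mu w (fst (stage S lam mu w (k - 1))) (snd (stage S lam mu w (k - 1)))"

definition num_stages ::
  "('i \<Rightarrow> 'n::finite set) \<Rightarrow> ('i \<Rightarrow> real) \<Rightarrow> ('n \<Rightarrow> real) \<Rightarrow> ('n \<Rightarrow> real) \<Rightarrow> nat" where
  "num_stages S lam mu w = (LEAST k. snd (stage S lam mu w k) = {})"

definition bonded ::
  "('i \<Rightarrow> 'n::finite set) \<Rightarrow> ('i \<Rightarrow> real) \<Rightarrow> ('n \<Rightarrow> real) \<Rightarrow> ('n \<Rightarrow> real) \<Rightarrow> nat \<Rightarrow> 'n set \<Rightarrow> bool" where
  "bonded S lam mu w k C \<longleftrightarrow> C \<noteq> {} \<and> C \<subseteq> stage_cluster S lam mu w k \<and>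
     (\<exists>\<pi> \<in> stage_policies S lam mu w k. \<forall>j\<in>C. \<forall>m\<in>C.
        (Inr j, Inr m) \<in> (bipartite (\<lambda>i j. i \<in> active lam \<and> \<pi> i j > 0))\<^sup>*)"


subsection \<open>The JLW random walk\<close>

definition shortest :: "('n \<Rightarrow> real) \<Rightarrow> 'n set \<Rightarrow> int ^ 'n \<Rightarrow> 'n::finite set" where
  "shortest w A x = {j \<in> A. w j * of_int (x $ j) = Min ((\<lambda>l. w l * of_int (x $ l)) ` A)}"

definition jlw_policy :: "('n \<Rightarrow> real) \<Rightarrow> ('i \<Rightarrow> 'n::finite set) \<Rightarrow> int ^ 'n \<Rightarrow> ('i, 'n) policy" where
  "jlw_policy w S x i j =
     (if j \<in> shortest w (S i) x then 1 / real (card (shortest w (S i) x)) else 0)"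

definition jlw_rate ::
  "('i \<Rightarrow> 'n::finite set) \<Rightarrow> ('i \<Rightarrow> real) \<Rightarrow> ('n \<Rightarrow> real) \<Rightarrow> ('n \<Rightarrow> real) \<Rightarrow> int ^ 'n \<Rightarrow> int ^ 'n \<Rightarrow> real" where
  "jlw_rate S lam mu w x y =
     (\<Sum>j\<in>UNIV.
        (if y = x + axis j 1
         then \<Sum>i | i \<in> active lam \<and> j \<in> S i. lam i * jlw_policy w S x i j else 0) +
        (if y = x - axis j 1 then mu j else 0))"

text \<open>
  Continuous-time Markov chains in the jump chain / holding time form. For rates \<open>q x y\<close>
  (with \<open>q x x = 0\<close> and finite positive exit rates), the process \<open>X\<close> under the probability measure
  \<open>M\<close> is the chain with jumps \<open>x \<mapsto> y\<close> at rate \<open>q x y\<close> started at \<open>x\<^sub>0\<close> if it runs through a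
  sequence of states \<open>Y\<^sub>0, Y\<^sub>1, \<dots>\<close>, spending time \<open>H\<^sub>n\<close> in \<open>Y\<^sub>n\<close>, where \<open>Y\<close> is the discrete-time
  Markov chain from \<open>x\<^sub>0\<close> with transition probabilities \<open>q x y / exit_rate q x\<close> and, given \<open>Y\<close>,
  the \<open>H\<^sub>n\<close> are independent and exponentially distributed with parameters \<open>exit_rate q (Y\<^sub>n)\<close>.
  The product formula below is the joint law of \<open>Y\<^sub>0, \<dots>, Y\<^sub>n, H\<^sub>0, \<dots>, H\<^sub>n\<^sub>-\<^sub>1\<close>.
\<close>

definition exit_rate :: "('s \<Rightarrow> 's \<Rightarrow> real) \<Rightarrow> 's \<Rightarrow> real" where
  "exit_rate q x = infsum (q x) UNIV"

definition markov_chain_from ::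
  "('s \<Rightarrow> 's \<Rightarrow> real) \<Rightarrow> 'w measure \<Rightarrow> (real \<Rightarrow> 'w \<Rightarrow> 's) \<Rightarrow> 's \<Rightarrow> bool" where
  "markov_chain_from q M X x\<^sub>0 \<longleftrightarrow>
     prob_space M \<and> (\<forall>t\<ge>0. X t \<in> measurable M (count_space UNIV)) \<and>
     (\<exists>Y H. (\<forall>n::nat. Y n \<in> measurable M (count_space UNIV)) \<and>
        (\<forall>n::nat. H n \<in> borel_measurable M) \<and>
        (\<forall>(n::nat) y t. (\<forall>k. 0 \<le> t k) \<longrightarrow>
           measure M {\<omega> \<in> space M. (\<forall>k\<le>n. Y k \<omega> = y k) \<and> (\<forall>k<n. t k < H k \<omega>)} =
             (if y 0 = x\<^sub>0 then 1 else 0) *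
             (\<Prod>k<n. q (y k) (y (Suc k)) / exit_rate q (y k) * exp (- exit_rate q (y k) * t k))) \<and>
        (AE \<omega> in M. \<forall>n t. (\<Sum>k<n. H k \<omega>) \<le> t \<and> t < (\<Sum>k<Suc n. H k \<omega>) \<longrightarrow> X t \<omega> = Y n \<omega>))"

definition weighted :: "('n \<Rightarrow> real) \<Rightarrow> (real \<Rightarrow> 'w \<Rightarrow> int ^ 'n) \<Rightarrow> real \<Rightarrow> 'w \<Rightarrow> real ^ 'n::finite" where
  "weighted w X t \<omega> = (\<chi> j. w j * of_int (X t \<omega> $ j))"


subsection \<open>Recurrence in shape\<close>

text \<open>
  \<open>P x\<close> is the law under which the underlying Markov chain starts at \<open>x\<close>; a process \<open>Z\<close> derived
  from the chain need not be Markov itself, so its initial states are those of the chain.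
\<close>

definition recurrent :: "('s \<Rightarrow> 'w measure) \<Rightarrow> (real \<Rightarrow> 'w \<Rightarrow> 'b::metric_space) \<Rightarrow> bool" where
  "recurrent P Z \<longleftrightarrow>
     (\<exists>B. bounded B \<and> (\<forall>x. AE \<omega> in P x. \<forall>T. \<exists>t\<ge>T. Z t \<omega> \<in> B))"

text \<open>Vectors indexed by \<open>C\<close> are embedded into \<open>real ^ 'n\<close> by filling up with zeros.\<close>

definition recurrent_in_shape ::
  "('s \<Rightarrow> 'w measure) \<Rightarrow> (real \<Rightarrow> 'w \<Rightarrow> real ^ 'n::finite) \<Rightarrow> 'n set \<Rightarrow> bool" where
  "recurrent_in_shape P Y C \<longleftrightarrow>
     (\<forall>j\<^sub>0\<in>C. recurrent P (\<lambda>t \<omega>. \<chi> j. if j \<in> C then Y t \<omega> $ j - Y t \<omega> $ j\<^sub>0 else 0))"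

end

theory Submission
  imports Defs
begin

text \<open>
  Every state of the random walk has the same exit rate \<open>\<Lambda>\<close>, the sum of all arrival and service rates.
  Up to a clock that is independent of the states and never stops ticking, the walk is therefore a
  chain in discrete time, and it suffices to find a Lyapunov function for this jump chain.

  The decomposition provides a static policy \<open>\<pi>\<close> with values \<open>v\<^sub>j = w\<^sub>j V(j; \<pi>)\<close>, where \<open>v\<^sub>j\<close> is the
  minimax value of the stage that treats \<open>j\<close>, such that

    (1) a station \<open>j\<close> that receives work from \<open>S\<^sub>i\<close> under \<open>\<pi>\<close> has the least \<open>v\<^sub>j\<close> within \<open>S\<^sub>i\<close>;

    (2) the bonded cluster \<open>C\<close> is connected in the graph \<open>G(\<pi>)\<close>

  (lemma \<open>bonded_adapted_policy\<close>). After \<open>n\<close> jumps let \<open>z\<^sub>j = w\<^sub>j x\<^sub>j - v\<^sub>j n / \<Lambda>\<close> and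
  \<open>\<Phi> = \<Sum>\<^sub>j z\<^sub>j\<^sup>2 / w\<^sub>j\<close>. Up to a bounded term of second order, the mean increment of \<open>\<Phi>\<close> is
  \<open>2 / \<Lambda>\<close> times the sum over \<open>i\<close> of \<open>\<lambda>\<^sub>i\<close> times the difference between the average of \<open>z\<close> under the
  JLW routing of \<open>i\<close> and its average under \<open>\<pi>(i)\<close>. The JLW policy joins a station of \<open>S\<^sub>i\<close> with the
  least \<open>w\<^sub>j x\<^sub>j\<close>, while the stations used by \<open>\<pi>\<close> have the least \<open>v\<^sub>j\<close> by (1); so the station joined has
  a \<open>z\<close> not exceeding the \<open>z\<close> of any station used by \<open>\<pi>\<close>. Hence the mean increment of \<open>\<Phi>\<close> is bounded
  above, and it is below a constant minus a multiple of \<open>\<bar>z\<^sub>a - z\<^sub>b\<bar>\<close> whenever \<open>\<pi>\<close> uses both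
  \<open>a\<close> and \<open>b\<close> for the same neighbourhood (lemma \<open>slack_lower_bound\<close>). Along the paths given by (2) these
  differences control \<open>z\<^sub>j - z\<^sub>m\<close> for all \<open>j, m \<in> C\<close>, which equals \<open>w\<^sub>j x\<^sub>j - w\<^sub>m x\<^sub>m\<close> because \<open>v\<close> is
  constant on \<open>C\<close>. So \<open>\<Phi>\<close> decreases on average by at least \<open>1\<close> in each step unless the shape of the walk
  on \<open>C\<close> is in a fixed bounded set (lemma \<open>potential_strict_drift\<close>), and Foster's criterion
  shows that this set is visited infinitely often.

  The centring by \<open>v\<^sub>j n / \<Lambda>\<close> is what allows all clusters to be treated at once. It removes
  the linear trend by which stations of different clusters drift apart, and where JLW routes an
  arrival to another cluster than \<open>\<pi>\<close> does, the difference of the centrings has the favourable sign by (1). The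
  price is a Lyapunov function that depends on time, which Foster's argument tolerates.
\<close>

section \<open>Structure of the minimax decomposition\<close>

locale network =
  fixes S :: "'i::finite \<Rightarrow> 'n::finite set" and lam :: "'i \<Rightarrow> real" and mu w :: "'n \<Rightarrow> real"
  assumes S_nonempty: "S i \<noteq> {}"
    and mu_pos: "mu j > 0"
    and w_pos: "w j > 0"
begin

abbreviation "static \<equiv> static_policies S lam"
abbreviation "V \<equiv> drift lam mu"

lemma staticD:
  assumes "\<pi> \<in> static" "i \<in> active lam"
  shows "0 \<le> \<pi> i j" "(\<Sum>j\<in>UNIV. \<pi> i j) = 1" "j \<notin> S i \<Longrightarrow> \<pi> i j = 0" "\<pi> i j \<noteq> 0 \<Longrightarrow> 0 < \<pi> i j"
  using assms by (auto simp: static_policies_def less_le)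

lemma max_drift_le_iff: "D \<noteq> {} \<Longrightarrow> max_drift lam mu w D \<pi> \<le> c \<longleftrightarrow> (\<forall>j\<in>D. w j * V \<pi> j \<le> c)"
  unfolding max_drift_def by simp

lemma max_drift_attained:
  "D \<noteq> {} \<Longrightarrow> \<exists>j\<in>D. w j * V \<pi> j = max_drift lam mu w D \<pi>"
  unfolding max_drift_def using Max_in[of "(\<lambda>j. w j * V \<pi> j) ` D"] by fastforce

lemma drift_cong: "(\<And>i. i \<in> active lam \<Longrightarrow> \<pi> i j = \<pi>' i j) \<Longrightarrow> V \<pi> j = V \<pi>' j"
  unfolding drift_def by simp

lemma max_drift_cong: "(\<And>j. j \<in> D \<Longrightarrow> V \<pi> j = V \<pi>' j) \<Longrightarrow> max_drift lam mu w D \<pi> = max_drift lam mu w D \<pi>'"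
  unfolding max_drift_def by (metis (mono_tags, lifting) image_cong)

lemma closed_policy_matrices:
  "closed {A :: real^'n^'i. (\<lambda>i j. A $ i $ j) \<in> static \<and> (\<forall>j\<in>U. w j * V (\<lambda>i j. A $ i $ j) j = v j)}"
proof -
  have 1: "closed {A :: real^'n^'i. (\<lambda>i j. A $ i $ j) \<in> static}"
    unfolding static_policies_def mem_Collect_eq Ball_def
    by (intro closed_Collect_all closed_Collect_imp closed_Collect_conj closed_Collect_le closed_Collect_eq
         continuous_intros) auto
  have 2: "closed {A :: real^'n^'i. \<forall>j. j \<in> U \<longrightarrow> w j * V (\<lambda>i j. A $ i $ j) j = v j}"
    unfolding drift_def
    by (intro closed_Collect_all closed_Collect_imp closed_Collect_eq continuous_intros) auto
  show ?thesis using closed_Collect_conj[OF 1 2] by (simp add: Ball_def)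
qed

lemma continuous_max_drift:
  assumes "D \<noteq> {}"
  shows "continuous_on K (\<lambda>A :: real^'n^'i. max_drift lam mu w D (\<lambda>i j. A $ i $ j))"
proof -
  have "finite D" by simp
  then show ?thesis using assms
  proof (induction D rule: finite_ne_induct)
    case (singleton j)
    show ?case unfolding max_drift_def drift_def by (auto intro!: continuous_intros)
  next
    case (insert j F)
    have "max_drift lam mu w (insert j F) \<pi> = max (w j * V \<pi> j) (max_drift lam mu w F \<pi>)" for \<pi>
      using insert by (simp add: max_drift_def)
    then show ?case using insert.IH unfolding drift_def by (auto intro!: continuous_intros)
  qed
qed

text \<open>
  The least element in the definition of the minimax value exists because a continuous function attains
  its minimum on a compact set. Policies are regarded as matrices with entries between \<open>0\<close> and \<open>1\<close>, which makes
  the closed set \<open>Q\<close> compact; no value is lost, as setting the rows of inactive indices to zero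
  leaves all drifts unchanged.
\<close>

lemma max_drift_attains_min:
  assumes D: "D \<noteq> {}" and Q: "Q = {\<pi> \<in> static. \<forall>j\<in>U. w j * V \<pi> j = v j}" "Q \<noteq> {}"
  shows "\<exists>\<pi>\<in>Q. \<forall>\<pi>'\<in>Q. max_drift lam mu w D \<pi> \<le> max_drift lam mu w D \<pi>'"
proof -
  define r :: "real^'n^'i \<Rightarrow> ('i, 'n) policy" where "r A = (\<lambda>i j. A $ i $ j)" for A
  define K where "K = {A. r A \<in> Q} \<inter> {A. \<forall>i j. 0 \<le> A $ i $ j} \<inter> {A. \<forall>i j. A $ i $ j \<le> 1}"
  have "closed {A. r A \<in> Q}"
    using closed_policy_matrices[of U v] by (simp add: Q r_def)
  then have "closed K"
    unfolding K_def
    by (intro closed_Int closed_Collect_all closed_Collect_le continuous_intros) auto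
  moreover have "norm A \<le> real CARD('i) * real CARD('n)" if "A \<in> K" for A
  proof -
    have "norm A \<le> (\<Sum>i\<in>UNIV. norm (A $ i))" by (simp add: norm_vec_def L2_set_le_sum)
    also have "\<dots> \<le> (\<Sum>i\<in>(UNIV::'i set). \<Sum>j\<in>UNIV. norm (A $ i $ j))"
      by (intro sum_mono) (simp add: norm_vec_def L2_set_le_sum)
    also have "\<dots> \<le> (\<Sum>i\<in>(UNIV::'i set). \<Sum>j\<in>(UNIV::'n set). 1)"
      using that by (intro sum_mono) (auto simp: K_def)
    finally show ?thesis by simp
  qed
  then have "bounded K" unfolding bounded_iff by blast
  ultimately have cK: "compact K" by (simp add: compact_eq_bounded_closed)
  have rep: "\<exists>A\<in>K. \<forall>j. V (r A) j = V \<pi> j" if "\<pi> \<in> Q" for \<pi>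
  proof -
    define A :: "real^'n^'i" where "A = (\<chi> i j. if i \<in> active lam then \<pi> i j else 0)"
    have st: "\<pi> \<in> static" using that Q by auto
    have r: "\<And>i j. i \<in> active lam \<Longrightarrow> r A i j = \<pi> i j" by (simp add: r_def A_def)
    then have V: "V (r A) j = V \<pi> j" for j by (intro drift_cong) auto
    have "r A \<in> static" using st r by (auto simp: static_policies_def)
    then have "r A \<in> Q" using V that Q by auto
    moreover have "\<pi> i j \<le> 1" if "i \<in> active lam" for i j
      using member_le_sum[of j UNIV "\<pi> i"] staticD[OF st that] by auto
    ultimately have "A \<in> K" using staticD(1)[OF st] by (auto simp: K_def A_def)
    then show ?thesis using V by blast
  qed
  have "K \<noteq> {}" using rep Q(2) by blast
  then obtain A where A: "A \<in> K" "\<And>B. B \<in> K \<Longrightarrow> max_drift lam mu w D (r A) \<le> max_drift lam mu w D (r B)"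
    using continuous_attains_inf[OF cK _ continuous_max_drift[OF D, of K]] unfolding r_def by blast
  show ?thesis
  proof (intro bexI ballI)
    show "r A \<in> Q" using A by (simp add: K_def)
    fix \<pi>' assume "\<pi>' \<in> Q"
    from rep[OF this] obtain B where B: "B \<in> K" "\<And>j. V (r B) j = V \<pi>' j" by blast
    from A(2)[OF B(1)] max_drift_cong[OF B(2)]
    show "max_drift lam mu w D (r A) \<le> max_drift lam mu w D \<pi>'" by simp
  qed
qed

lemma minimax_value_least:
  assumes "\<pi> \<in> Q" "\<And>\<pi>'. \<pi>' \<in> Q \<Longrightarrow> max_drift lam mu w D \<pi> \<le> max_drift lam mu w D \<pi>'"
  shows "minimax_value lam mu w Q D = max_drift lam mu w D \<pi>"
  unfolding minimax_value_def using assms by (intro Least_equality) auto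

text \<open>
  What is known before each further stage: \<open>D\<close> contains the stations still to be treated, and \<open>v\<close> gives
  the weighted drifts of the others. Fixing these drifts is all that \<open>Q\<close> demands of a static policy. A
  neighbourhood with some arrivals routed outside \<open>D\<close> does not meet \<open>D\<close>, and these arrivals go to
  stations with the least \<open>v\<close> in it. The last conjunct says that later stages cannot have larger values than earlier ones.
\<close>

definition settled :: "('n \<Rightarrow> real) \<Rightarrow> ('i, 'n) policy set \<times> 'n set \<Rightarrow> bool" where
  "settled v QD \<longleftrightarrow> (case QD of (Q, D) \<Rightarrow>
     Q = {\<pi> \<in> static. \<forall>j\<in>-D. w j * V \<pi> j = v j} \<and>
     (\<forall>\<pi>\<in>Q. \<forall>i\<in>active lam. \<forall>j\<in>-D. \<pi> i j > 0 \<longrightarrow> S i \<inter> D = {} \<and> (\<forall>m\<in>S i. v j \<le> v m)) \<and>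
     (\<exists>\<pi>\<in>Q. \<forall>j\<in>D. \<forall>m\<in>-D. w j * V \<pi> j \<le> v m))"

text \<open>
  The perturbation behind the minimality of clusters.
\<close>

lemma move_mass:
  assumes st: "\<pi> \<in> static" and i: "i \<in> active lam" and m: "m \<in> S i" and jm: "j \<noteq> m"
    and e: "0 \<le> e" "e \<le> \<pi> i j"
  defines "\<pi>' \<equiv> \<pi>(i := (\<pi> i)(j := \<pi> i j - e, m := \<pi> i m + e))"
  shows "\<pi>' \<in> static" "V \<pi>' j = V \<pi> j - lam i * e" "V \<pi>' m = V \<pi> m + lam i * e"
    "l \<noteq> j \<Longrightarrow> l \<noteq> m \<Longrightarrow> V \<pi>' l = V \<pi> l"
proof -
  have row: "\<pi>' i l = \<pi> i l + (if l = m then e else 0) - (if l = j then e else 0)" for l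
    using jm by (auto simp: \<pi>'_def)
  have other: "\<pi>' a l = \<pi> a l" if "a \<noteq> i" for a l using that by (simp add: \<pi>'_def)
  have sum1: "(\<Sum>l\<in>UNIV. \<pi>' i l) = 1"
    unfolding row using staticD(2)[OF st i] by (simp add: sum.distrib sum_subtractf)
  have pos: "0 \<le> \<pi>' a l" if "a \<in> active lam" for a l
    using staticD(1)[OF st that, of l] row[of l] other[of a l] e by (cases "a = i") (auto split: if_splits)
  have supp: "\<pi>' a l = 0" if "a \<in> active lam" "l \<notin> S a" for a l
    using staticD(3)[OF st that] row[of l] other[of a l] e m that by (cases "a = i") (auto split: if_splits)
  have "(\<Sum>l\<in>UNIV. \<pi>' a l) = 1" if "a \<in> active lam" for a
    using sum1 other staticD(2)[OF st that] by (cases "a = i") auto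
  then show "\<pi>' \<in> static" using pos supp by (simp add: static_policies_def)
  have "\<pi>' a l = \<pi> a l + (if a = i then (if l = m then e else 0) - (if l = j then e else 0) else 0)" for a l
    using row other by auto
  then have "lam a * \<pi>' a l = lam a * \<pi> a l +
      (if a = i then lam i * ((if l = m then e else 0) - (if l = j then e else 0)) else 0)" for a l
    by (simp add: distrib_left)
  then have "V \<pi>' l = V \<pi> l + lam i * ((if l = m then e else 0) - (if l = j then e else 0))" for l
    using i by (simp add: drift_def sum.distrib)
  then show "V \<pi>' j = V \<pi> j - lam i * e" "V \<pi>' m = V \<pi> m + lam i * e"
    "l \<noteq> j \<Longrightarrow> l \<noteq> m \<Longrightarrow> V \<pi>' l = V \<pi> l"
    using jm by auto
qed

lemma settledD:
  assumes "settled v (Q, D)"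
  shows "\<pi> \<in> Q \<longleftrightarrow> \<pi> \<in> static \<and> (\<forall>j. j \<notin> D \<longrightarrow> w j * V \<pi> j = v j)"
    and "\<pi> \<in> Q \<Longrightarrow> i \<in> active lam \<Longrightarrow> j \<notin> D \<Longrightarrow> \<pi> i j > 0 \<Longrightarrow> S i \<inter> D = {}"
    and "\<pi> \<in> Q \<Longrightarrow> i \<in> active lam \<Longrightarrow> j \<notin> D \<Longrightarrow> \<pi> i j > 0 \<Longrightarrow> m \<in> S i \<Longrightarrow> v j \<le> v m"
    and "\<exists>\<pi>\<in>Q. \<forall>j\<in>D. \<forall>m. m \<notin> D \<longrightarrow> w j * V \<pi> j \<le> v m"
  using assms by (auto simp: settled_def)

lemma settled_0: "settled v (stage S lam mu w 0)"
proof -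
  have "(\<lambda>i j. if j = (SOME j. j \<in> S i) then 1 else 0) \<in> static"
    using S_nonempty by (auto simp: static_policies_def some_in_eq)
  then show ?thesis by (auto simp: settled_def)
qed

lemma minimax_cluster_optimal:
  assumes settled: "settled v (Q, D)" and D: "D \<noteq> {}"
  defines "val \<equiv> minimax_value lam mu w Q D" and "C \<equiv> minimax_cluster lam mu w Q D"
  shows "\<exists>\<pi>\<in>Q. max_drift lam mu w D \<pi> = val \<and> C = {j \<in> D. w j * V \<pi> j = val} \<and>
    (\<forall>\<pi>'\<in>Q. val \<le> max_drift lam mu w D \<pi>') \<and>
    (\<forall>\<pi>'\<in>Q. max_drift lam mu w D \<pi>' = val \<longrightarrow> card C \<le> card {j \<in> D. w j * V \<pi>' j = val})"
proof -
  have "Q = {\<pi> \<in> static. \<forall>j\<in>-D. w j * V \<pi> j = v j}" "Q \<noteq> {}"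
    using settledD(1,4)[OF settled] by auto
  from max_drift_attains_min[OF D this]
  obtain p where p: "p \<in> Q" "\<And>\<pi>'. \<pi>' \<in> Q \<Longrightarrow> max_drift lam mu w D p \<le> max_drift lam mu w D \<pi>'"
    by blast
  have val: "val = max_drift lam mu w D p"
    unfolding val_def by (rule minimax_value_least[OF p])
  define Opt where "Opt = (\<lambda>C. \<exists>\<pi>\<in>Q. max_drift lam mu w D \<pi> = val \<and> C = {j \<in> D. w j * V \<pi> j = val})"
  have "Opt {j \<in> D. w j * V p j = val}" unfolding Opt_def using p(1) val by auto
  from arg_min_nat_lemma[of Opt, OF this, of card]
  have C: "Opt C" "\<And>C'. Opt C' \<Longrightarrow> card C \<le> card C'"
    unfolding C_def minimax_cluster_def Opt_def val_def by auto
  from C(1) obtain \<pi> where "\<pi> \<in> Q" "max_drift lam mu w D \<pi> = val" "C = {j \<in> D. w j * V \<pi> j = val}"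
    unfolding Opt_def by blast
  moreover have "card C \<le> card {j \<in> D. w j * V \<pi>' j = val}"
    if "\<pi>' \<in> Q" "max_drift lam mu w D \<pi>' = val" for \<pi>'
    using C(2) that unfolding Opt_def by blast
  moreover have "\<forall>\<pi>'\<in>Q. val \<le> max_drift lam mu w D \<pi>'" using p(2) val by simp
  ultimately show ?thesis by blast
qed

text \<open>
  Call a station of \<open>D\<close> critical if its weighted drift is \<open>val\<close>. If an optimal policy with the fewest
  critical stations sent to a critical station \<open>j\<close> work from a neighbourhood with a non-critical
  station \<open>m\<close> of \<open>D\<close>, then moving a little of this work to \<open>m\<close> would relieve \<open>j\<close> without making \<open>m\<close>
  critical: there would be fewer critical stations, or the maximum would drop.
\<close>

lemma optimal_policy_flow:
  assumes settled: "settled v (Q, D)" and D: "D \<noteq> {}"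
    and \<pi>: "\<pi> \<in> Q" "max_drift lam mu w D \<pi> = val" "C = {j \<in> D. w j * V \<pi> j = val}"
    and val: "\<And>\<pi>'. \<pi>' \<in> Q \<Longrightarrow> val \<le> max_drift lam mu w D \<pi>'"
    and card: "\<And>\<pi>'. \<pi>' \<in> Q \<Longrightarrow> max_drift lam mu w D \<pi>' = val \<Longrightarrow> card C \<le> card {j \<in> D. w j * V \<pi>' j = val}"
    and i: "i \<in> active lam" and j: "j \<in> C" "\<pi> i j > 0"
  shows "S i \<inter> (D - C) = {}"
proof (rule ccontr)
  assume "S i \<inter> (D - C) \<noteq> {}"
  then obtain m where m: "m \<in> S i" "m \<in> D" "m \<notin> C" by auto
  have st: "\<pi> \<in> static" using settledD(1)[OF settled] \<pi>(1) by simp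
  have le: "w l * V \<pi> l \<le> val" if "l \<in> D" for l using \<pi>(2) max_drift_le_iff[OF D] that by auto
  have lt: "w m * V \<pi> m < val" using le[OF m(2)] m \<pi>(3) by auto
  have lam: "lam i > 0" using i by (simp add: active_def)
  \<comment> \<open>the second bound keeps station \<open>m\<close> strictly below the maximum\<close>
  define e where "e = min (\<pi> i j) ((val - w m * V \<pi> m) / (2 * w m * lam i))"
  have e: "0 < e" "e \<le> \<pi> i j" "w m * (lam i * e) < val - w m * V \<pi> m"
  proof -
    have q: "0 < (val - w m * V \<pi> m) / (2 * w m * lam i)" using lt lam w_pos[of m] by simp
    show "0 < e" "e \<le> \<pi> i j" using q j by (auto simp: e_def)
    have "w m * lam i * e \<le> w m * lam i * ((val - w m * V \<pi> m) / (2 * w m * lam i))"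
      using lam w_pos[of m] by (intro mult_left_mono) (auto simp: e_def)
    also have "\<dots> = (val - w m * V \<pi> m) / 2" using lam w_pos[of m] by (simp add: field_simps)
    also have "\<dots> < val - w m * V \<pi> m" using lt by simp
    finally show "w m * (lam i * e) < val - w m * V \<pi> m" by (simp add: mult.assoc)
  qed
  define p where "p = \<pi>(i := (\<pi> i)(j := \<pi> i j - e, m := \<pi> i m + e))"
  have jm: "j \<noteq> m" using j m by auto
  note p = move_mass[OF st i m(1) jm less_imp_le[OF e(1)] e(2), folded p_def]
  have pj: "w j * V p j < val"
    using p(2) j(1) \<pi>(3) mult_pos_pos[OF w_pos[of j] mult_pos_pos[OF lam e(1)]] by (auto simp: right_diff_distrib)
  have pm: "w m * V p m < val" using p(3) e(3) by (simp add: distrib_left)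
  have pl: "V p l = V \<pi> l" if "l \<noteq> j" "l \<noteq> m" for l using p(4) that by simp
  have pQ: "p \<in> Q"
  proof -
    have "V p l = V \<pi> l" if "l \<notin> D" for l
      by (rule pl) (use that j m \<pi>(3) in auto)
    then show ?thesis using p(1) \<pi>(1) settledD(1)[OF settled] by auto
  qed
  have "w l * V p l \<le> val" if "l \<in> D" for l
    using pj pm le[OF that] pl[of l] by (cases "l = j"; cases "l = m") auto
  then have "max_drift lam mu w D p = val"
    using val[OF pQ] max_drift_le_iff[OF D] by (metis antisym)
  then have "card C \<le> card {j \<in> D. w j * V p j = val}" using card pQ by blast
  moreover have "{j \<in> D. w j * V p j = val} \<subseteq> C - {j}"
    using pj pm pl \<pi>(3) by (smt (verit) Diff_iff mem_Collect_eq singletonD subsetI)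
  then have "card {j \<in> D. w j * V p j = val} \<le> card (C - {j})" by (intro card_mono) auto
  moreover have "card (C - {j}) < card C" using j(1) by (intro psubset_card_mono) auto
  ultimately show False by simp
qed

text \<open>
  The cluster \<open>C\<close> must receive all arrivals at neighbourhoods that meet \<open>D\<close> only inside \<open>C\<close>. By the
  previous lemma an optimal policy sends it nothing else, so it minimises the total
  flow into \<open>C\<close> over all of \<open>Q\<close>. A policy whose weighted drifts on \<open>C\<close> are at most \<open>val\<close> cannot bring less flow,
  hence it has the same drift at every station of \<open>C\<close> and sends no foreign arrivals there.
\<close>

lemma minimax_policies:
  assumes settled: "settled v (Q, D)" and D: "D \<noteq> {}"
  defines "val \<equiv> minimax_value lam mu w Q D" and "C \<equiv> minimax_cluster lam mu w Q D"
  shows "C \<noteq> {}" "C \<subseteq> D"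
    and "max_drift lam mu w C \<pi> = val \<Longrightarrow> \<pi> \<in> Q \<Longrightarrow> j \<in> C \<Longrightarrow> w j * V \<pi> j = val"
    and "max_drift lam mu w C \<pi> = val \<Longrightarrow> \<pi> \<in> Q \<Longrightarrow> j \<in> C \<Longrightarrow> i \<in> active lam \<Longrightarrow> \<pi> i j > 0 \<Longrightarrow>
      S i \<inter> (D - C) = {}"
    and "\<exists>\<pi>\<in>Q. max_drift lam mu w C \<pi> = val \<and> (\<forall>j\<in>D. w j * V \<pi> j \<le> val)"
    and "\<pi> \<in> Q \<Longrightarrow> val \<le> max_drift lam mu w D \<pi>"
proof -
  obtain p where p: "p \<in> Q" "max_drift lam mu w D p = val" "C = {j \<in> D. w j * V p j = val}"
    and opt: "\<forall>\<pi>'\<in>Q. val \<le> max_drift lam mu w D \<pi>'"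
      "\<forall>\<pi>'\<in>Q. max_drift lam mu w D \<pi>' = val \<longrightarrow> card C \<le> card {j \<in> D. w j * V \<pi>' j = val}"
    using minimax_cluster_optimal[OF settled D, folded val_def C_def] by (elim bexE conjE)
  have val: "\<And>\<pi>'. \<pi>' \<in> Q \<Longrightarrow> val \<le> max_drift lam mu w D \<pi>'"
    and card: "\<And>\<pi>'. \<pi>' \<in> Q \<Longrightarrow> max_drift lam mu w D \<pi>' = val \<Longrightarrow> card C \<le> card {j \<in> D. w j * V \<pi>' j = val}"
    using opt by auto
  show ne: "C \<noteq> {}" and CD: "C \<subseteq> D" using max_drift_attained[OF D, of p] p by auto
  show "\<pi> \<in> Q \<Longrightarrow> val \<le> max_drift lam mu w D \<pi>" using val .
  have "max_drift lam mu w C p = val" using max_drift_attained[OF ne, of p] p(3) by auto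
  moreover have "\<forall>j\<in>D. w j * V p j \<le> val" using max_drift_le_iff[OF D, of p val] p(2) by simp
  ultimately show "\<exists>\<pi>\<in>Q. max_drift lam mu w C \<pi> = val \<and> (\<forall>j\<in>D. w j * V \<pi> j \<le> val)"
    using p(1) by blast
  have flow_p: "S i \<inter> (D - C) = {}" if "i \<in> active lam" "j \<in> C" "p i j > 0" for i j
    using optimal_policy_flow[OF settled D p val card that] .

  \<comment> \<open>the share of the arrivals at \<open>S i\<close> that every policy of \<open>Q\<close> must send to \<open>C\<close>\<close>
  define g :: "'i \<Rightarrow> real" where "g i = (if S i \<inter> D \<noteq> {} \<and> S i \<inter> (D - C) = {} then 1 else 0)" for i
  have ge: "g i \<le> (\<Sum>j\<in>C. \<pi> i j)" if "\<pi> \<in> Q" and i: "i \<in> active lam" for \<pi> i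
  proof (cases "g i = 0")
    case True
    have "\<pi> \<in> static" using that settledD(1)[OF settled] by simp
    then show ?thesis using staticD(1)[OF _ i] True by (simp add: sum_nonneg)
  next
    case False
    have st: "\<pi> \<in> static" using that settledD(1)[OF settled] by simp
    from False have g: "S i \<inter> D \<noteq> {}" "S i \<inter> (D - C) = {}" "g i = 1" by (auto simp: g_def split: if_splits)
    have "\<pi> i j = 0" if "j \<notin> C" for j
    proof (cases "j \<in> D")
      case True
      then show ?thesis using staticD(3)[OF st i] g that by auto
    next
      case False
      then show ?thesis using settledD(2)[OF settled \<open>\<pi> \<in> Q\<close> i False] g staticD(4)[OF st i] by blast
    qed
    then have "(\<Sum>j\<in>C. \<pi> i j) = (\<Sum>j\<in>UNIV. \<pi> i j)" by (intro sum.mono_neutral_left) auto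
    then show ?thesis using staticD(2)[OF st i] g by simp
  qed
  have eq: "(\<Sum>j\<in>C. p i j) = g i" if i: "i \<in> active lam" for i
  proof (cases "g i = 0")
    case True
    have st: "p \<in> static" using p settledD(1)[OF settled] by simp
    have "p i j = 0" if "j \<in> C" for j
    proof (cases "S i \<inter> D = {}")
      case True
      then show ?thesis using staticD(3)[OF st i] that CD by auto
    next
      case False
      then have "S i \<inter> (D - C) \<noteq> {}" using \<open>g i = 0\<close> by (auto simp: g_def split: if_splits)
      then show ?thesis using flow_p[OF i that] staticD(4)[OF st i] by blast
    qed
    then show ?thesis using True by simp
  next
    case False
    have st: "p \<in> static" using p settledD(1)[OF settled] by simp
    have "(\<Sum>j\<in>C. p i j) \<le> (\<Sum>j\<in>UNIV. p i j)" using staticD(1)[OF st i] by (intro sum_mono2) auto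
    then show ?thesis using ge[OF p(1) i] False staticD(2)[OF st i] by (auto simp: g_def split: if_splits)
  qed
  have flow: "(\<Sum>j\<in>C. V \<pi> j) = (\<Sum>i\<in>active lam. lam i * (\<Sum>j\<in>C. \<pi> i j)) - (\<Sum>j\<in>C. mu j)" for \<pi>
    unfolding drift_def sum_subtractf sum_distrib_left by (subst sum.swap) simp
  have main: "(\<forall>j\<in>C. V \<pi> j = V p j) \<and> (\<forall>i\<in>active lam. (\<Sum>j\<in>C. \<pi> i j) = g i)"
    if max: "max_drift lam mu w C \<pi> = val" and \<pi>: "\<pi> \<in> Q" for \<pi>
  proof -
    have le: "V \<pi> j \<le> V p j" if "j \<in> C" for j
    proof -
      have "w j * V \<pi> j \<le> w j * V p j" using max max_drift_le_iff[OF ne, of \<pi> val] that p(3) by auto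
      then show ?thesis using w_pos[of j] by simp
    qed
    have le2: "lam i * (\<Sum>j\<in>C. p i j) \<le> lam i * (\<Sum>j\<in>C. \<pi> i j)" if "i \<in> active lam" for i
      using ge[OF \<pi> that] eq[OF that] that by (intro mult_left_mono) (auto simp: active_def)
    have "(\<Sum>j\<in>C. V \<pi> j) \<le> (\<Sum>j\<in>C. V p j)" using le by (rule sum_mono)
    moreover have "(\<Sum>j\<in>C. V p j) \<le> (\<Sum>j\<in>C. V \<pi> j)" unfolding flow using sum_mono[OF le2] by simp
    ultimately have s: "(\<Sum>j\<in>C. V \<pi> j) = (\<Sum>j\<in>C. V p j)" by simp
    have 1: "V \<pi> j = V p j" if "j \<in> C" for j
      using sum_mono_inv[OF s le that] by simp
    have s2: "(\<Sum>i\<in>active lam. lam i * (\<Sum>j\<in>C. p i j)) = (\<Sum>i\<in>active lam. lam i * (\<Sum>j\<in>C. \<pi> i j))"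
      using s unfolding flow by simp
    have "(\<Sum>j\<in>C. \<pi> i j) = g i" if "i \<in> active lam" for i
      using sum_mono_inv[OF s2 le2 that] that eq[OF that] by (auto simp: active_def)
    then show ?thesis using 1 by blast
  qed
  show "w j * V \<pi> j = val" if "max_drift lam mu w C \<pi> = val" "\<pi> \<in> Q" "j \<in> C"
    using main[OF that(1,2)] that(3) p(3) by auto
  show "S i \<inter> (D - C) = {}"
    if "max_drift lam mu w C \<pi> = val" "\<pi> \<in> Q" and j: "j \<in> C" and i: "i \<in> active lam" and pos: "\<pi> i j > 0"
  proof -
    have st: "\<pi> \<in> static" using that settledD(1)[OF settled] by simp
    have "\<pi> i j \<le> (\<Sum>j\<in>C. \<pi> i j)" using staticD(1)[OF st i] j by (intro member_le_sum) auto
    then have "g i \<noteq> 0" using main[OF that(1,2)] i pos by auto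
    then show ?thesis by (auto simp: g_def split: if_splits)
  qed
qed

text \<open>
  The value of the new stage is at most \<open>v m\<close> for every station \<open>m\<close> treated before, because a policy with this
  bound on all drifts in \<open>D\<close> was at hand.
\<close>

lemma settled_step:
  assumes settled: "settled v (Q, D)" and D: "D \<noteq> {}"
  defines "val \<equiv> minimax_value lam mu w Q D" and "C \<equiv> minimax_cluster lam mu w Q D"
  shows "settled (\<lambda>j. if j \<in> C then val else v j) ({\<pi> \<in> Q. max_drift lam mu w C \<pi> = val}, D - C)"
    (is "settled ?v (?Q, _)")
proof -
  note m = minimax_policies[OF settled D, folded val_def C_def]
  obtain \<pi>\<^sub>0 where \<pi>\<^sub>0: "\<pi>\<^sub>0 \<in> Q" "\<And>j m. j \<in> D \<Longrightarrow> m \<notin> D \<Longrightarrow> w j * V \<pi>\<^sub>0 j \<le> v m"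
    using settledD(4)[OF settled] by blast
  have val_le: "val \<le> v m" if "m \<notin> D" for m
    using m(6)[OF \<pi>\<^sub>0(1)] max_drift_le_iff[OF D, of \<pi>\<^sub>0 "v m"] \<pi>\<^sub>0(2) that by auto
  have "?Q = {\<pi> \<in> static. \<forall>j\<in>-(D - C). w j * V \<pi> j = ?v j}"
  proof (intro equalityI subsetI)
    fix \<pi> assume "\<pi> \<in> ?Q"
    then show "\<pi> \<in> {\<pi> \<in> static. \<forall>j\<in>-(D - C). w j * V \<pi> j = ?v j}"
      using settledD(1)[OF settled, of \<pi>] m(3)[of \<pi>] by auto
  next
    fix \<pi> assume \<pi>: "\<pi> \<in> {\<pi> \<in> static. \<forall>j\<in>-(D - C). w j * V \<pi> j = ?v j}"
    then have 1: "w j * V \<pi> j = val" if "j \<in> C" for j using that by auto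
    have "w j * V \<pi> j = v j" if "j \<notin> D" for j using that m(2) \<pi> by auto
    then have "\<pi> \<in> Q" using \<pi> settledD(1)[OF settled, of \<pi>] by auto
    then show "\<pi> \<in> ?Q" using max_drift_attained[OF m(1), of \<pi>] 1 by auto
  qed
  moreover have "S i \<inter> (D - C) = {} \<and> (\<forall>m\<in>S i. ?v j \<le> ?v m)"
    if "\<pi> \<in> ?Q" and i: "i \<in> active lam" and j: "j \<notin> D - C" "\<pi> i j > 0" for \<pi> i j
  proof (cases "j \<in> C")
    case True
    then have *: "S i \<inter> (D - C) = {}" using m(4)[of \<pi> j i] that by auto
    have "?v j \<le> ?v l" if "l \<in> S i" for l using * that True val_le[of l] by auto
    then show ?thesis using * by blast
  next
    case False
    then have jD: "j \<notin> D" using j by simp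
    have "\<pi> \<in> Q" using that by simp
    note ** = settledD(2,3)[OF settled this i jD j(2)]
    then show ?thesis using False m(2) by auto
  qed
  moreover have "\<exists>\<pi>\<in>?Q. \<forall>j\<in>D - C. \<forall>m\<in>-(D - C). w j * V \<pi> j \<le> ?v m"
  proof -
    obtain \<pi> where \<pi>: "\<pi> \<in> Q" "max_drift lam mu w C \<pi> = val" "\<And>j. j \<in> D \<Longrightarrow> w j * V \<pi> j \<le> val"
      using m(5) by blast
    have "w j * V \<pi> j \<le> ?v l" if "j \<in> D - C" "l \<in> -(D - C)" for j l
      using \<pi>(3)[of j] val_le[of l] that by (cases "l \<in> C") (auto intro: order_trans)
    then show ?thesis using \<pi> by blast
  qed
  ultimately show ?thesis unfolding settled_def by auto
qed

lemma settled_stage: "\<exists>v. settled v (stage S lam mu w k)"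
proof (induction k)
  case 0
  show ?case using settled_0 by blast
next
  case (Suc k)
  then obtain v where v: "settled v (stage S lam mu w k)" by blast
  obtain Q D where QD: "stage S lam mu w k = (Q, D)" by fastforce
  show ?case
  proof (cases "D = {}")
    case True then show ?thesis using v QD by auto
  next
    case False
    then show ?thesis using settled_step[of v Q D] v QD by (auto simp: Let_def)
  qed
qed

lemma stage_Suc:
  assumes "stage S lam mu w k = (Q, D)" "D \<noteq> {}"
  shows "stage S lam mu w (Suc k) =
    ({\<pi> \<in> Q. max_drift lam mu w (minimax_cluster lam mu w Q D) \<pi> = minimax_value lam mu w Q D},
      D - minimax_cluster lam mu w Q D)"
  using assms by (simp add: Let_def)

lemma stage_policies_antimono: "k \<le> l \<Longrightarrow> stage_policies S lam mu w l \<subseteq> stage_policies S lam mu w k"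
  by (rule lift_Suc_antimono_le) (auto simp: stage_policies_def Let_def)

lemma final_stage: "snd (stage S lam mu w (num_stages S lam mu w)) = {}"
proof -
  have "card (snd (stage S lam mu w k)) \<le> card (UNIV :: 'n set) - k" for k
  proof (induction k)
    case 0 then show ?case by simp
  next
    case (Suc k)
    obtain Q D where QD: "stage S lam mu w k = (Q, D)" by fastforce
    show ?case
    proof (cases "D = {}")
      case True then show ?thesis using QD by simp
    next
      case False
      from settled_stage obtain v where "settled v (Q, D)" using QD by metis
      note m = minimax_policies(1,2)[OF this False]
      have "card (D - minimax_cluster lam mu w Q D) < card D"
        using m by (intro psubset_card_mono) auto
      then show ?thesis using Suc stage_Suc[OF QD False] QD by simp
    qed
  qed
  from this[of "card (UNIV :: 'n set)"] have "snd (stage S lam mu w (card (UNIV :: 'n set))) = {}" by simp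
  then show ?thesis unfolding num_stages_def by (rule LeastI)
qed

text \<open>
  What the Lyapunov function needs of the decomposition: a policy with weighted drifts \<open>v\<close> that sends no
  arrival to a station while one with a smaller value of \<open>v\<close> is available.
\<close>

definition adapted :: "('i, 'n) policy \<Rightarrow> ('n \<Rightarrow> real) \<Rightarrow> bool" where
  "adapted \<pi> v \<longleftrightarrow> \<pi> \<in> static \<and> (\<forall>j. w j * V \<pi> j = v j) \<and>
     (\<forall>i\<in>active lam. \<forall>j. \<pi> i j > 0 \<longrightarrow> (\<forall>m\<in>S i. v j \<le> v m))"

abbreviation "graph \<pi> \<equiv> bipartite (\<lambda>i j. i \<in> active lam \<and> \<pi> i j > 0)"

text \<open>
  The policy that witnesses bondedness is optimal up to stage \<open>k\<close> only. It is glued to a policy \<open>r\<close> of the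
  final stage: the rows of neighbourhoods that do not meet the stations \<open>D\<close> left after stage \<open>k\<close> come from
  the former, all other rows from \<open>r\<close>. Both policies send the rows of the first kind outside \<open>D\<close> and those of the second
  kind into \<open>D\<close>, so every station keeps the drift it has under the policy that serves it, and the paths
  between stations of \<open>C\<close> survive since they never enter \<open>D\<close>.
\<close>

lemma bonded_adapted_policy:
  assumes k: "1 \<le> k" "k \<le> num_stages S lam mu w" and bonded: "bonded S lam mu w k C"
  obtains \<pi> v where "adapted \<pi> v" "\<forall>j\<in>C. \<forall>m\<in>C. (Inr j, Inr m) \<in> (graph \<pi>)\<^sup>*"
proof -
  let ?st = "stage S lam mu w"
  obtain Q D where QD: "?st k = (Q, D)" by fastforce
  obtain u where u: "settled u (Q, D)" using settled_stage QD by metis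
  obtain p where p: "p \<in> Q" "\<And>j m. j \<in> C \<Longrightarrow> m \<in> C \<Longrightarrow> (Inr j, Inr m) \<in> (graph p)\<^sup>*"
    using bonded QD by (auto simp: bonded_def stage_policies_def)
  have CD: "C \<inter> D = {}"
  proof -
    obtain l where l: "k = Suc l" using k by (cases k) auto
    obtain Q' D' where QD': "?st l = (Q', D')" by fastforce
    have "D' \<noteq> {}" using not_less_Least[of l "\<lambda>k. snd (?st k) = {}"] k QD'
      by (auto simp: num_stages_def l)
    from stage_Suc[OF QD' this] have "D = D' - minimax_cluster lam mu w Q' D'" using QD l by simp
    moreover have "C \<subseteq> minimax_cluster lam mu w Q' D'"
      using bonded l QD' by (simp add: bonded_def stage_cluster_def)
    ultimately show ?thesis by blast
  qed
  obtain R E where RE: "?st (num_stages S lam mu w) = (R, E)" by fastforce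
  then have E: "E = {}" using final_stage by simp
  obtain v where v: "settled v (R, {})" using settled_stage RE E by metis
  obtain r where r: "r \<in> R" using settledD(4)[OF v] by blast
  have rQ: "r \<in> Q" using stage_policies_antimono[OF k(2)] r RE QD by (auto simp: stage_policies_def)
  define q where "q i = (if S i \<inter> D = {} then p i else r i)" for i
  have st: "p \<in> static" "r \<in> static" using p(1) rQ settledD(1)[OF u] by auto
  have "q \<in> static" using st by (auto simp: q_def static_policies_def)
  have "w j * V q j = v j" for j
  proof (cases "j \<in> D")
    case True
    have "V q j = V r j"
    proof (rule drift_cong)
      fix i assume i: "i \<in> active lam"
      have "p i j = r i j" if "S i \<inter> D = {}"
      proof -
        have "j \<notin> S i" using that True by blast
        then show ?thesis using staticD(3)[OF st(1) i] staticD(3)[OF st(2) i] by simp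
      qed
      then show "q i j = r i j" by (simp add: q_def)
    qed
    then show ?thesis using settledD(1)[OF v] r by simp
  next
    case False
    have "V q j = V p j"
    proof (rule drift_cong)
      fix i assume i: "i \<in> active lam"
      have "p i j = r i j" if "S i \<inter> D \<noteq> {}"
      proof -
        have "\<not> p i j > 0" "\<not> r i j > 0"
          using settledD(2)[OF u _ i False] p(1) rQ that by blast+
        then show ?thesis using staticD(4)[OF st(1) i] staticD(4)[OF st(2) i] by metis
      qed
      then show "q i j = p i j" by (simp add: q_def)
    qed
    moreover have "w j * V p j = w j * V r j" using settledD(1)[OF u] p(1) rQ False by metis
    moreover have "w j * V r j = v j" using settledD(1)[OF v] r by simp
    ultimately show ?thesis by simp
  qed
  then have qR: "q \<in> R" using settledD(1)[OF v] \<open>q \<in> static\<close> by simp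
  have "adapted q v"
    unfolding adapted_def using settledD(1,3)[OF v] qR by auto
  moreover have "(Inr j, Inr m) \<in> (graph q)\<^sup>*" if "j \<in> C" "m \<in> C" for j m
  proof -
    have "(Inr j, x) \<in> (graph q)\<^sup>* \<and> (case x of Inl i \<Rightarrow> S i \<inter> D = {} | Inr l \<Rightarrow> l \<notin> D)"
      if "(Inr j, x) \<in> (graph p)\<^sup>*" for x
      using that
    proof (induction rule: rtrancl_induct)
      case base
      then show ?case using \<open>j \<in> C\<close> CD by auto
    next
      case (step x y)
      have "(x, y) \<in> graph q \<and> (case y of Inl i \<Rightarrow> S i \<inter> D = {} | Inr l \<Rightarrow> l \<notin> D)"
      proof (cases x)
        case (Inl i)
        then obtain l where l: "y = Inr l" "i \<in> active lam" "p i l > 0"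
          using step by (auto simp: bipartite_def)
        have "S i \<inter> D = {}" using step.IH Inl by simp
        moreover have "l \<in> S i" using staticD(3)[OF st(1) l(2), of l] l(3) by force
        ultimately show ?thesis using l Inl by (auto simp: bipartite_def q_def)
      next
        case (Inr l)
        then obtain i where i: "y = Inl i" "i \<in> active lam" "p i l > 0"
          using step by (auto simp: bipartite_def)
        have "S i \<inter> D = {}" using settledD(2)[OF u p(1) i(2) _ i(3)] step.IH Inr by simp
        then show ?thesis using i Inr by (auto simp: bipartite_def q_def)
      qed
      then show ?case using step.IH by (meson rtrancl.rtrancl_into_rtrancl)
    qed
    then show ?thesis using p(2)[OF that] by blast
  qed
  ultimately show thesis using that by blast
qed

end

section \<open>Drift of the centred quadratic potential\<close>

text \<open>
  If \<open>\<rho>\<close> only charges points where \<open>z\<close> is not larger than at any point charged by \<open>\<pi>\<close>, then the mean of \<open>z\<close>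
  under \<open>\<rho>\<close> is at most \<open>z b\<close>, and the mean under \<open>\<pi>\<close> exceeds it at least by the contribution of a single point \<open>a\<close>.
\<close>

lemma coupling_gap:
  fixes \<pi> \<rho> z :: "'a::finite \<Rightarrow> real"
  assumes \<pi>: "\<And>j. 0 \<le> \<pi> j" "(\<Sum>j\<in>UNIV. \<pi> j) = 1" and \<rho>: "\<And>j. 0 \<le> \<rho> j" "(\<Sum>j\<in>UNIV. \<rho> j) = 1"
    and le: "\<And>j m. \<rho> j > 0 \<Longrightarrow> \<pi> m > 0 \<Longrightarrow> z j \<le> z m" and b: "\<pi> b > 0"
  shows "\<pi> a * (z a - z b) \<le> (\<Sum>j\<in>UNIV. \<pi> j * z j) - (\<Sum>j\<in>UNIV. \<rho> j * z j)"
proof -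
  let ?Z = "\<Sum>j\<in>UNIV. \<rho> j * z j"
  have Z: "?Z \<le> z m" if "\<pi> m > 0" for m
  proof -
    have "\<rho> j * z j \<le> \<rho> j * z m" for j
      using \<rho>(1)[of j] le[OF _ that, of j] by (cases "\<rho> j = 0") (auto intro!: mult_left_mono)
    then have "?Z \<le> (\<Sum>j\<in>UNIV. \<rho> j * z m)" by (intro sum_mono)
    then show ?thesis by (simp add: \<rho>(2) sum_distrib_right[symmetric])
  qed
  have nonneg: "0 \<le> \<pi> j * (z j - ?Z)" for j
    using \<pi>(1)[of j] Z[of j] by (cases "\<pi> j = 0") auto
  have "\<pi> a * (z a - z b) \<le> \<pi> a * (z a - ?Z)" using Z[OF b] \<pi>(1) by (intro mult_left_mono) auto
  also have "\<dots> \<le> (\<Sum>j\<in>UNIV. \<pi> j * (z j - ?Z))"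
    using nonneg by (intro member_le_sum) auto
  also have "\<dots> = (\<Sum>j\<in>UNIV. \<pi> j * z j) - ?Z"
    by (simp add: right_diff_distrib sum_subtractf sum_distrib_right[symmetric] \<pi>(2))
  finally show ?thesis .
qed

context network begin

abbreviation "jlw \<equiv> jlw_policy w S"

lemma shortest_iff: "j \<in> shortest w (S i) x \<longleftrightarrow>
    j \<in> S i \<and> (\<forall>m\<in>S i. w j * of_int (x $ j) \<le> w m * of_int (x $ m))"
  unfolding shortest_def mem_Collect_eq
  by (rule conj_cong[OF refl]) (subst eq_commute, subst Min_eq_iff, auto)

lemma jlw_static: "jlw x \<in> static"
proof -
  have "(\<Sum>j\<in>UNIV. jlw x i j) = 1" for i
  proof -
    let ?B = "shortest w (S i) x"
    have "Min ((\<lambda>l. w l * of_int (x $ l)) ` S i) \<in> (\<lambda>l. w l * of_int (x $ l)) ` S i"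
      using S_nonempty by (intro Min_in) auto
    then have "?B \<noteq> {}" unfolding shortest_def by force
    then have "card ?B \<noteq> 0" by simp
    then show ?thesis by (simp add: jlw_policy_def sum.If_cases)
  qed
  then show ?thesis
    by (auto simp: static_policies_def jlw_policy_def shortest_def)
qed

lemma jlw_joins_shortest:
  assumes "jlw x i j > 0"
  shows "j \<in> S i" "m \<in> S i \<Longrightarrow> w j * of_int (x $ j) \<le> w m * of_int (x $ m)"
  using assms shortest_iff by (auto simp: jlw_policy_def split: if_splits)

text \<open>
  The common exit rate of all states.
\<close>

definition total_rate :: real where
  "total_rate = (\<Sum>i\<in>active lam. lam i) + (\<Sum>j\<in>UNIV. mu j)"

lemma total_rate_pos: "total_rate > 0"
proof -
  have "(\<Sum>j\<in>UNIV. mu j) > 0" using mu_pos by (intro sum_pos) auto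
  moreover have "(\<Sum>i\<in>active lam. lam i) \<ge> 0" by (intro sum_nonneg) (simp add: active_def)
  ultimately show ?thesis by (simp add: total_rate_def)
qed

abbreviation "rate \<equiv> jlw_rate S lam mu w"

definition neighbours :: "int ^ 'n \<Rightarrow> (int ^ 'n) set" where
  "neighbours x = range (\<lambda>j. x + axis j 1) \<union> range (\<lambda>j. x - axis j 1)"

lemma finite_neighbours: "finite (neighbours x)"
  by (simp add: neighbours_def)

lemma jlw_rate_eq:
  "rate x y = (\<Sum>j\<in>UNIV. (if y = x + axis j 1 then V (jlw x) j + mu j else 0) + (if y = x - axis j 1 then mu j else 0))"
proof -
  have "(\<Sum>i | i \<in> active lam \<and> j \<in> S i. lam i * jlw x i j) = V (jlw x) j + mu j" for j
  proof -
    have "(\<Sum>i | i \<in> active lam \<and> j \<in> S i. lam i * jlw x i j) = (\<Sum>i\<in>active lam. lam i * jlw x i j)"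
    proof (rule sum.mono_neutral_left)
      show "\<forall>i\<in>active lam - {i. i \<in> active lam \<and> j \<in> S i}. lam i * jlw x i j = 0"
        by (simp add: staticD(3)[OF jlw_static])
    qed auto
    then show ?thesis by (simp add: drift_def)
  qed
  then show ?thesis unfolding jlw_rate_def by (simp cong: if_cong)
qed

lemma arrival_nonneg: "\<pi> \<in> static \<Longrightarrow> 0 \<le> V \<pi> j + mu j"
  unfolding drift_def using staticD(1) by (auto intro!: sum_nonneg simp: active_def)

lemma jlw_rate_nonneg: "0 \<le> rate x y"
  unfolding jlw_rate_eq using arrival_nonneg[OF jlw_static] mu_pos
  by (intro sum_nonneg add_nonneg_nonneg) (auto intro: less_imp_le)

lemma jlw_rate_support: "y \<notin> neighbours x \<Longrightarrow> rate x y = 0"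
  unfolding jlw_rate_eq neighbours_def by (intro sum.neutral) auto

lemma sum_jlw_rate:
  "(\<Sum>y\<in>neighbours x. rate x y * f y) =
    (\<Sum>j\<in>UNIV. (V (jlw x) j + mu j) * f (x + axis j 1) + mu j * f (x - axis j 1))"
proof -
  have "(\<Sum>y\<in>neighbours x. rate x y * f y) = (\<Sum>j\<in>UNIV. \<Sum>y\<in>neighbours x.
      (if y = x + axis j 1 then (V (jlw x) j + mu j) * f y else 0) + (if y = x - axis j 1 then mu j * f y else 0))"
    unfolding jlw_rate_eq sum_distrib_right
    by (subst sum.swap) (simp only: distrib_right if_distrib[of "\<lambda>t. t * f y" for y] mult_zero_left)
  also have "\<dots> = (\<Sum>j\<in>UNIV. (V (jlw x) j + mu j) * f (x + axis j 1) + mu j * f (x - axis j 1))"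
  proof (rule sum.cong[OF refl])
    fix j
    have "x + axis j 1 \<in> neighbours x" "x - axis j 1 \<in> neighbours x" by (auto simp: neighbours_def)
    then show "(\<Sum>y\<in>neighbours x. (if y = x + axis j 1 then (V (jlw x) j + mu j) * f y else 0) +
        (if y = x - axis j 1 then mu j * f y else 0)) =
        (V (jlw x) j + mu j) * f (x + axis j 1) + mu j * f (x - axis j 1)"
      using finite_neighbours by (simp add: sum.distrib)
  qed
  finally show ?thesis .
qed

lemma drift_total: "\<pi> \<in> static \<Longrightarrow> (\<Sum>j\<in>UNIV. (V \<pi> j + mu j) + mu j) = total_rate"
proof -
  assume \<pi>: "\<pi> \<in> static"
  have "(\<Sum>j\<in>UNIV. \<Sum>i\<in>active lam. lam i * \<pi> i j) = (\<Sum>i\<in>active lam. \<Sum>j\<in>UNIV. lam i * \<pi> i j)"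
    by (rule sum.swap)
  also have "\<dots> = (\<Sum>i\<in>active lam. lam i)"
    using staticD(2)[OF \<pi>] by (simp add: sum_distrib_left[symmetric])
  finally show ?thesis by (simp add: drift_def total_rate_def sum.distrib)
qed

lemma exit_rate_jlw: "exit_rate rate x = total_rate"
proof -
  have "exit_rate rate x = infsum (rate x) (neighbours x)"
    unfolding exit_rate_def by (rule infsum_cong_neutral) (auto simp: jlw_rate_support)
  also have "\<dots> = (\<Sum>y\<in>neighbours x. rate x y * 1)" using finite_neighbours by simp
  also have "\<dots> = total_rate" unfolding sum_jlw_rate using drift_total[OF jlw_static] by simp
  finally show ?thesis .
qed

definition jump_prob :: "int ^ 'n \<Rightarrow> int ^ 'n \<Rightarrow> real" where
  "jump_prob x y = rate x y / total_rate"

lemma jump_prob_nonneg: "0 \<le> jump_prob x y"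
  using jlw_rate_nonneg total_rate_pos by (simp add: jump_prob_def)

lemma nn_integral_jump_prob:
  assumes f: "\<And>y. 0 \<le> f y"
  shows "(\<integral>\<^sup>+y. ennreal (jump_prob x y) * ennreal (f y) \<partial>count_space UNIV) = ennreal
    ((\<Sum>j\<in>UNIV. (V (jlw x) j + mu j) * f (x + axis j 1) + mu j * f (x - axis j 1)) / total_rate)"
proof -
  have "(\<integral>\<^sup>+y. ennreal (jump_prob x y) * ennreal (f y) \<partial>count_space UNIV) =
      (\<Sum>y\<in>neighbours x. ennreal (jump_prob x y) * ennreal (f y))"
    by (rule nn_integral_count_space') (auto simp: finite_neighbours jump_prob_def jlw_rate_support)
  also have "\<dots> = ennreal (\<Sum>y\<in>neighbours x. jump_prob x y * f y)"
    using jump_prob_nonneg f by (simp add: ennreal_mult[symmetric] sum_ennreal)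
  also have "(\<Sum>y\<in>neighbours x. jump_prob x y * f y) = (\<Sum>y\<in>neighbours x. rate x y * f y) / total_rate"
    by (simp add: jump_prob_def sum_divide_distrib)
  finally show ?thesis unfolding sum_jlw_rate .
qed

lemma jump_prob_stochastic: "(\<integral>\<^sup>+y. ennreal (jump_prob x y) \<partial>count_space UNIV) = 1"
  using nn_integral_jump_prob[of "\<lambda>_. 1" x] drift_total[OF jlw_static, of x] total_rate_pos by simp

text \<open>
  The weighted queue at \<open>j\<close>, measured from the point that moves at the constant rate \<open>v j\<close>: one jump takes time
  \<open>1 / total_rate\<close> on average.
\<close>

definition deviation :: "('n \<Rightarrow> real) \<Rightarrow> nat \<Rightarrow> int ^ 'n \<Rightarrow> 'n \<Rightarrow> real" where
  "deviation v n x j = w j * of_int (x $ j) - v j / total_rate * real n"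

text \<open>
  The weights \<open>1 / w j\<close> cancel the jump size \<open>w j\<close> of the deviation, so that the first-order part of the mean
  increment pairs the deviations with the unweighted drifts, in which the routing is linear.
\<close>

definition potential :: "('n \<Rightarrow> real) \<Rightarrow> nat \<Rightarrow> int ^ 'n \<Rightarrow> real" where
  "potential v n x = (\<Sum>j\<in>UNIV. (deviation v n x j)\<^sup>2 / w j)"

text \<open>
  A bound for the quadratic part of the increments of the potential.
\<close>

definition noise :: "('n \<Rightarrow> real) \<Rightarrow> real" where
  "noise v = (\<Sum>j\<in>UNIV. (w j + \<bar>v j\<bar> / total_rate)\<^sup>2 / w j)"

text \<open>
  The decrease of the potential to first order: in one jump its mean falls at least by \<open>2 / total_rate\<close> times the
  slack, less the noise.
\<close>

definition slack :: "('i, 'n) policy \<Rightarrow> ('n \<Rightarrow> real) \<Rightarrow> nat \<Rightarrow> int ^ 'n \<Rightarrow> real" where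
  "slack \<pi> v n x = (\<Sum>j\<in>UNIV. deviation v n x j * (V \<pi> j - V (jlw x) j))"

lemma potential_nonneg: "0 \<le> potential v n x"
  unfolding potential_def using w_pos by (intro sum_nonneg divide_nonneg_nonneg) (auto intro: less_imp_le)

lemma noise_nonneg: "0 \<le> noise v"
  unfolding noise_def using w_pos by (intro sum_nonneg divide_nonneg_nonneg) (auto intro: less_imp_le)

lemma potential_jump:
  assumes v: "\<And>j. w j * V \<pi> j = v j" and s: "s = 1 \<or> s = -1"
  shows "potential v (Suc n) (x + axis l s) \<le>
    potential v n x + noise v + 2 * of_int s * deviation v n x l
      - 2 / total_rate * (\<Sum>j\<in>UNIV. deviation v n x j * V \<pi> j)"
proof -
  let ?z = "deviation v n x"
  \<comment> \<open>increment of the deviation of \<open>j\<close> when station \<open>l\<close> changes by \<open>s\<close>\<close>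
  define d where "d j = (if j = l then w j * of_int s else 0) - v j / total_rate" for j
  have dev: "deviation v (Suc n) (x + axis l s) j = ?z j + d j" for j
    by (auto simp: deviation_def d_def axis_def algebra_simps add_divide_distrib)
  have d: "(d j)\<^sup>2 \<le> (w j + \<bar>v j\<bar> / total_rate)\<^sup>2" for j
  proof (rule abs_le_square_iff[THEN iffD1])
    have "\<bar>d j\<bar> \<le> \<bar>if j = l then w j * of_int s else 0\<bar> + \<bar>v j / total_rate\<bar>"
      unfolding d_def by (rule abs_triangle_ineq4)
    also have "\<dots> \<le> w j + \<bar>v j\<bar> / total_rate"
      using s w_pos[of j] total_rate_pos by (auto simp: abs_mult)
    finally show "\<bar>d j\<bar> \<le> \<bar>w j + \<bar>v j\<bar> / total_rate\<bar>" by simp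
  qed
  have le: "(deviation v (Suc n) (x + axis l s) j)\<^sup>2 / w j \<le>
      (?z j)\<^sup>2 / w j + (w j + \<bar>v j\<bar> / total_rate)\<^sup>2 / w j
        + 2 * ((if j = l then of_int s * ?z j else 0) - ?z j * V \<pi> j / total_rate)" for j
  proof -
    have "(deviation v (Suc n) (x + axis l s) j)\<^sup>2 / w j = (?z j)\<^sup>2 / w j + (d j)\<^sup>2 / w j + 2 * (?z j * (d j / w j))"
      unfolding dev using w_pos[of j] by (simp add: power2_sum add_divide_distrib)
    also have "d j / w j = (if j = l then of_int s else 0) - V \<pi> j / total_rate"
      using w_pos[of j] v[of j, symmetric] by (auto simp: d_def diff_divide_distrib)
    finally show ?thesis
      using divide_right_mono[OF d[of j], of "w j"] w_pos[of j] by (auto simp: algebra_simps)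
  qed
  have "potential v (Suc n) (x + axis l s) \<le> (\<Sum>j\<in>UNIV. (?z j)\<^sup>2 / w j + (w j + \<bar>v j\<bar> / total_rate)\<^sup>2 / w j
      + 2 * ((if j = l then of_int s * ?z j else 0) - ?z j * V \<pi> j / total_rate))"
    unfolding potential_def by (rule sum_mono) (rule le)
  also have "\<dots> = potential v n x + noise v
      + 2 * ((\<Sum>j\<in>UNIV. if j = l then of_int s * ?z j else 0) - (\<Sum>j\<in>UNIV. ?z j * V \<pi> j / total_rate))"
    unfolding potential_def noise_def by (simp only: sum.distrib sum_subtractf sum_distrib_left[symmetric])
  finally show ?thesis by (simp add: sum_divide_distrib[symmetric])
qed

definition next_potential :: "('n \<Rightarrow> real) \<Rightarrow> nat \<Rightarrow> int ^ 'n \<Rightarrow> real" where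
  "next_potential v n x = (\<Sum>j\<in>UNIV. (V (jlw x) j + mu j) * potential v (Suc n) (x + axis j 1) +
      mu j * potential v (Suc n) (x - axis j 1)) / total_rate"

lemma nn_integral_next_potential:
  "(\<integral>\<^sup>+y. ennreal (jump_prob x y) * ennreal (potential v (Suc n) y) \<partial>count_space UNIV) = ennreal (next_potential v n x)"
  unfolding next_potential_def by (rule nn_integral_jump_prob) (rule potential_nonneg)

lemma next_potential_nonneg: "0 \<le> next_potential v n x"
  unfolding next_potential_def
  using potential_nonneg arrival_nonneg[OF jlw_static] mu_pos total_rate_pos
  by (intro divide_nonneg_nonneg sum_nonneg add_nonneg_nonneg[OF mult_nonneg_nonneg mult_nonneg_nonneg])
    (auto intro: less_imp_le)

text \<open>
  Summed against the jump rates, the linear terms of the increments combine to the difference of the drifts under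
  \<open>\<pi>\<close> and under JLW, since the centring is chosen to be the drift of \<open>\<pi>\<close>.
\<close>

lemma potential_drift:
  assumes v: "\<And>j. w j * V \<pi> j = v j"
  shows "next_potential v n x \<le> potential v n x + noise v - 2 / total_rate * slack \<pi> v n x"
proof -
  let ?z = "deviation v n x" and ?a = "\<lambda>j. V (jlw x) j + mu j"
  let ?u = "\<Sum>j\<in>UNIV. ?z j * V \<pi> j"
  define c where "c = potential v n x + noise v - 2 / total_rate * ?u"
  have le: "?a j * potential v (Suc n) (x + axis j 1) + mu j * potential v (Suc n) (x - axis j 1) \<le>
      (?a j + mu j) * c + 2 * (?z j * V (jlw x) j)" for j
  proof -
    have neg: "x - axis j 1 = x + axis j (- 1)" by (simp add: vec_eq_iff axis_def)
    have "?a j * potential v (Suc n) (x + axis j 1) \<le> ?a j * (c + 2 * ?z j)"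
      using potential_jump[OF v, of 1 n x j] arrival_nonneg[OF jlw_static, of x j]
      by (intro mult_left_mono) (auto simp: c_def)
    moreover have "mu j * potential v (Suc n) (x - axis j 1) \<le> mu j * (c - 2 * ?z j)"
      using potential_jump[OF v, of "-1" n x j] mu_pos[of j] unfolding neg
      by (intro mult_left_mono) (auto simp: c_def)
    ultimately show ?thesis by (simp add: algebra_simps)
  qed
  have "(\<Sum>j\<in>UNIV. ?a j * potential v (Suc n) (x + axis j 1) + mu j * potential v (Suc n) (x - axis j 1)) \<le>
      (\<Sum>j\<in>UNIV. (?a j + mu j) * c + 2 * (?z j * V (jlw x) j))"
    by (rule sum_mono) (rule le)
  also have "\<dots> = (\<Sum>j\<in>UNIV. ?a j + mu j) * c + 2 * (\<Sum>j\<in>UNIV. ?z j * V (jlw x) j)"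
    by (subst sum.distrib) (simp only: sum_distrib_left sum_distrib_right)
  also have "(\<Sum>j\<in>UNIV. ?a j + mu j) = total_rate"
    by (rule drift_total[OF jlw_static])
  finally have "(\<Sum>j\<in>UNIV. ?a j * potential v (Suc n) (x + axis j 1) + mu j * potential v (Suc n) (x - axis j 1)) \<le>
      total_rate * c + 2 * (\<Sum>j\<in>UNIV. ?z j * V (jlw x) j)" .
  then have "(\<Sum>j\<in>UNIV. ?a j * potential v (Suc n) (x + axis j 1) + mu j * potential v (Suc n) (x - axis j 1)) / total_rate \<le>
      (total_rate * c + 2 * (\<Sum>j\<in>UNIV. ?z j * V (jlw x) j)) / total_rate"
    using total_rate_pos by (intro divide_right_mono) auto
  also have "\<dots> = potential v n x + noise v - 2 / total_rate * slack \<pi> v n x"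
    using total_rate_pos unfolding slack_def c_def
    by (simp add: field_simps sum_subtractf)
  finally show ?thesis by (simp only: next_potential_def)
qed

text \<open>
  The station \<open>j\<close> joined under JLW minimises \<open>w j * x $ j\<close> over \<open>S i\<close>, and a station \<open>m\<close> used by \<open>\<pi>\<close> satisfies
  \<open>v m \<le> v j\<close>, so the deviation of \<open>j\<close> is at most that of \<open>m\<close>. The slack is the sum, weighted by the arrival rates, of
  the gaps between the averages of the deviation under the two policies, none of which is negative.
\<close>

lemma slack_lower_bound:
  assumes ad: "adapted \<pi> v"
  shows "0 \<le> slack \<pi> v n x"
    and "i \<in> active lam \<Longrightarrow> \<pi> i b > 0 \<Longrightarrow>
      lam i * \<pi> i a * (deviation v n x a - deviation v n x b) \<le> slack \<pi> v n x"
proof -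
  let ?z = "deviation v n x"
  define gap where "gap k = (\<Sum>j\<in>UNIV. \<pi> k j * ?z j) - (\<Sum>j\<in>UNIV. jlw x k j * ?z j)" for k
  have st: "\<pi> \<in> static" using ad by (simp add: adapted_def)
  have gap: "\<pi> k a * (?z a - ?z b) \<le> gap k" if k: "k \<in> active lam" and "\<pi> k b > 0" for k a b
    unfolding gap_def
  proof (rule coupling_gap)
    fix j m assume j: "jlw x k j > 0" and m: "\<pi> k m > 0"
    have mS: "m \<in> S k" using staticD(3)[OF st k, of m] m by force
    have "v m \<le> v j" using ad k m jlw_joins_shortest(1)[OF j] by (auto simp: adapted_def)
    then have "v m / total_rate * real n \<le> v j / total_rate * real n"
      using total_rate_pos by (intro mult_right_mono divide_right_mono) auto
    then show "?z j \<le> ?z m"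
      using jlw_joins_shortest(2)[OF j mS] by (simp add: deviation_def)
  qed (use staticD[OF st k] staticD[OF jlw_static k] that in auto)
  have gap_nonneg: "0 \<le> gap k" if k: "k \<in> active lam" for k
  proof -
    obtain b where "\<pi> k b \<noteq> 0" using staticD(2)[OF st k] by (metis sum.neutral zero_neq_one)
    then show ?thesis using gap[OF k, of b b] staticD(4)[OF st k] by simp
  qed
  have "slack \<pi> v n x = (\<Sum>j\<in>UNIV. \<Sum>k\<in>active lam. lam k * (\<pi> k j * ?z j - jlw x k j * ?z j))"
    unfolding slack_def drift_def
    by (intro sum.cong refl) (simp add: sum_subtractf[symmetric] sum_distrib_left algebra_simps)
  also have "\<dots> = (\<Sum>k\<in>active lam. lam k * gap k)"
    unfolding gap_def by (subst sum.swap) (simp add: sum_distrib_left[symmetric] sum_subtractf)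
  finally have slack: "slack \<pi> v n x = (\<Sum>k\<in>active lam. lam k * gap k)" .
  show "0 \<le> slack \<pi> v n x"
    unfolding slack using gap_nonneg by (intro sum_nonneg) (auto simp: active_def)
  assume i: "i \<in> active lam" and b: "\<pi> i b > 0"
  have "lam i * (\<pi> i a * (?z a - ?z b)) \<le> lam i * gap i"
    using gap[OF i b] i by (intro mult_left_mono) (auto simp: active_def)
  also have "\<dots> \<le> slack \<pi> v n x"
    unfolding slack using gap_nonneg i by (intro member_le_sum) (auto simp: active_def)
  finally show "lam i * \<pi> i a * (?z a - ?z b) \<le> slack \<pi> v n x" by (simp add: mult.assoc)
qed

definition row_oscillation_le :: "('i, 'n) policy \<Rightarrow> ('n \<Rightarrow> real) \<Rightarrow> real \<Rightarrow> bool" where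
  "row_oscillation_le \<pi> z s \<longleftrightarrow> (\<forall>i\<in>active lam. \<forall>a b. \<pi> i a > 0 \<longrightarrow> \<pi> i b > 0 \<longrightarrow> \<bar>z a - z b\<bar> \<le> s)"

text \<open>
  Every step of a path between stations contributes at most one row oscillation. The constant
  depends on the path only, not on the function \<open>z\<close>; in particular it is uniform in the state and the time.
\<close>

lemma connected_oscillation:
  assumes "(Inr j, Inr m) \<in> (graph \<pi>)\<^sup>*"
  shows "\<exists>c\<ge>0. \<forall>z s. 0 \<le> s \<longrightarrow> row_oscillation_le \<pi> z s \<longrightarrow> \<bar>z j - z m\<bar> \<le> c * s"
proof -
  define osc where "osc c a \<longleftrightarrow> (\<forall>z s. 0 \<le> s \<longrightarrow> row_oscillation_le \<pi> z s \<longrightarrow> \<bar>z j - z a\<bar> \<le> c * s)"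
    for c :: real and a
  have "case x of Inr a \<Rightarrow> \<exists>c\<ge>0. osc c a | Inl i \<Rightarrow> \<exists>c\<ge>0. \<forall>a. \<pi> i a > 0 \<longrightarrow> osc c a"
    if "(Inr j, x) \<in> (graph \<pi>)\<^sup>*" for x
    using that
  proof (induction rule: rtrancl_induct)
    case base
    have "osc 0 j" by (simp add: osc_def)
    then show ?case by auto
  next
    case (step x y)
    show ?case
    proof (cases x)
      case (Inl i)
      then obtain a where a: "y = Inr a" "\<pi> i a > 0"
        using step.hyps by (auto simp: bipartite_def)
      then show ?thesis using step.IH Inl by auto
    next
      case (Inr a)
      then obtain i where i: "y = Inl i" "i \<in> active lam" "\<pi> i a > 0"
        using step.hyps by (auto simp: bipartite_def)
      obtain c where c: "c \<ge> 0" "osc c a" using step.IH Inr by auto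
      have "osc (c + 1) b" if "\<pi> i b > 0" for b
        unfolding osc_def
      proof (intro allI impI)
        fix z :: "'n \<Rightarrow> real" and s
        assume s: "0 \<le> s" and z: "row_oscillation_le \<pi> z s"
        have "\<bar>z j - z a\<bar> \<le> c * s" using c(2) s z unfolding osc_def by blast
        moreover have "\<bar>z a - z b\<bar> \<le> s" using z i(2,3) that unfolding row_oscillation_le_def by blast
        ultimately show "\<bar>z j - z b\<bar> \<le> (c + 1) * s" by (simp add: distrib_right)
      qed
      moreover have "c + 1 \<ge> 0" using c by simp
      ultimately show ?thesis using i(1) by auto
    qed
  qed
  from this[OF assms] show ?thesis by (simp add: osc_def)
qed

definition shape_within :: "'n set \<Rightarrow> real \<Rightarrow> (int ^ 'n) set" where
  "shape_within C R = {x. \<forall>j\<in>C. \<forall>m\<in>C. \<bar>w j * of_int (x $ j) - w m * of_int (x $ m)\<bar> \<le> R}"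

lemma potential_weak_drift:
  assumes ad: "adapted \<pi> v"
  shows "next_potential v n x \<le> potential v n x + noise v"
proof -
  have v: "\<And>j. w j * V \<pi> j = v j" using ad by (auto simp: adapted_def)
  have "0 \<le> 2 / total_rate * slack \<pi> v n x"
    using slack_lower_bound(1)[OF ad] total_rate_pos by (intro mult_nonneg_nonneg) auto
  then show ?thesis using potential_drift[OF v, of n x] by linarith
qed

text \<open>
  Outside \<open>shape_within C R\<close> the deviations differ by more than \<open>R\<close> at two stations of \<open>C\<close>, hence differ
  noticeably for some neighbourhood on the path between them, and the slack there outweighs the noise.
\<close>

lemma potential_strict_drift:
  assumes ad: "adapted \<pi> v" and conn: "\<forall>j\<in>C. \<forall>m\<in>C. (Inr j, Inr m) \<in> (graph \<pi>)\<^sup>*"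
  shows "\<exists>R. \<forall>n x. x \<notin> shape_within C R \<longrightarrow> next_potential v n x + 1 \<le> potential v n x"
proof -
  have v: "\<And>j. w j * V \<pi> j = v j" and st: "\<pi> \<in> static" using ad by (auto simp: adapted_def)
  let ?T = total_rate
  note T = total_rate_pos
  have "\<forall>j m. \<exists>c. j \<in> C \<longrightarrow> m \<in> C \<longrightarrow> c \<ge> 0 \<and>
      (\<forall>z s. 0 \<le> s \<longrightarrow> row_oscillation_le \<pi> z s \<longrightarrow> \<bar>z j - z m\<bar> \<le> c * s)"
    using connected_oscillation conn by blast
  then obtain c where c: "\<And>j m. j \<in> C \<Longrightarrow> m \<in> C \<Longrightarrow> c j m \<ge> 0"
    "\<And>j m z s. j \<in> C \<Longrightarrow> m \<in> C \<Longrightarrow> 0 \<le> s \<Longrightarrow> row_oscillation_le \<pi> z s \<Longrightarrow> \<bar>z j - z m\<bar> \<le> c j m * s"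
    unfolding choice_iff by blast
  \<comment> \<open>one constant that serves all pairs of stations in \<open>C\<close>\<close>
  define c\<^sub>1 where "c\<^sub>1 = 1 + (\<Sum>(j, m)\<in>C \<times> C. c j m)"
  have c\<^sub>1: "c\<^sub>1 > 0" "\<And>j m. j \<in> C \<Longrightarrow> m \<in> C \<Longrightarrow> c j m \<le> c\<^sub>1"
  proof -
    have "0 \<le> (\<Sum>(j, m)\<in>C \<times> C. c j m)" using c(1) by (intro sum_nonneg) auto
    then show "c\<^sub>1 > 0" by (simp add: c\<^sub>1_def)
    fix j m assume "j \<in> C" "m \<in> C"
    then have "(\<lambda>(j, m). c j m) (j, m) \<le> (\<Sum>(j, m)\<in>C \<times> C. c j m)" using c(1) by (intro member_le_sum) auto
    then show "c j m \<le> c\<^sub>1" by (simp add: c\<^sub>1_def)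
  qed
  \<comment> \<open>the \<open>1\<close> makes the minimum meaningful when there are no arrivals at all\<close>
  define \<delta> where "\<delta> = Min (insert 1 {lam i * \<pi> i a | i a. i \<in> active lam \<and> \<pi> i a > 0})"
  have fin: "finite (insert 1 {lam i * \<pi> i a | i a. i \<in> active lam \<and> \<pi> i a > 0})"
  proof -
    have "{lam i * \<pi> i a | i a. i \<in> active lam \<and> \<pi> i a > 0} \<subseteq> range (\<lambda>(i, a). lam i * \<pi> i a)" by force
    from finite_subset[OF this finite_imageI[OF finite]] show ?thesis by simp
  qed
  have \<delta>: "\<delta> > 0" "\<And>i a. i \<in> active lam \<Longrightarrow> \<pi> i a > 0 \<Longrightarrow> \<delta> \<le> lam i * \<pi> i a"
    unfolding \<delta>_def using fin by (auto simp: active_def intro!: Min_le)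
  have v_eq: "v j = v m" if "j \<in> C" "m \<in> C" for j m
  proof -
    \<comment> \<open>\<open>v\<close> is minimal in \<open>S i\<close> at both \<open>a\<close> and \<open>b\<close>\<close>
    have "row_oscillation_le \<pi> v 0"
      unfolding row_oscillation_le_def
    proof (intro ballI allI impI)
      fix i a b assume i: "i \<in> active lam" "\<pi> i a > 0" "\<pi> i b > 0"
      then have "a \<in> S i" "b \<in> S i" using staticD(3)[OF st i(1)] by force+
      then have "v a \<le> v b" "v b \<le> v a" using ad i by (auto simp: adapted_def)
      then show "\<bar>v a - v b\<bar> \<le> 0" by simp
    qed
    from c(2)[OF that _ this] show ?thesis by simp
  qed
  \<comment> \<open>solves \<open>2 / ?T * s = noise v + 1\<close> for the slack \<open>s\<close>, where \<open>R = c\<^sub>1 * (s / \<delta>)\<close>\<close>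
  define R where "R = c\<^sub>1 * ((noise v + 1) * ?T / 2 / \<delta>)"
  have "next_potential v n x + 1 \<le> potential v n x"
    if j: "j \<in> C" and m: "m \<in> C" and far: "R < \<bar>w j * of_int (x $ j) - w m * of_int (x $ m)\<bar>" for n x j m
  proof -
    let ?z = "deviation v n x" and ?s = "slack \<pi> v n x"
    have s: "0 \<le> ?s / \<delta>" using slack_lower_bound(1)[OF ad] \<delta>(1) by simp
    have "row_oscillation_le \<pi> ?z (?s / \<delta>)"
      unfolding row_oscillation_le_def
    proof (intro ballI allI impI)
      fix i a b assume i: "i \<in> active lam" "\<pi> i a > 0" "\<pi> i b > 0"
      have half: "?z a - ?z b \<le> ?s / \<delta>" if i: "i \<in> active lam" "\<pi> i a > 0" "\<pi> i b > 0" for a b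
      proof (cases "?z a \<le> ?z b")
        case True
        then show ?thesis using s by simp
      next
        case False
        then have "\<delta> * (?z a - ?z b) \<le> lam i * \<pi> i a * (?z a - ?z b)"
          using \<delta>(2)[OF i(1,2)] by (intro mult_right_mono) auto
        also have "\<dots> \<le> ?s" by (rule slack_lower_bound(2)[OF ad i(1,3)])
        finally show ?thesis using \<delta>(1) by (simp add: field_simps)
      qed
      show "\<bar>?z a - ?z b\<bar> \<le> ?s / \<delta>"
        using half[OF i] half[OF i(1,3,2)] by simp
    qed
    then have "\<bar>?z j - ?z m\<bar> \<le> c j m * (?s / \<delta>)" using c(2)[OF j m s] by simp
    also have "\<dots> \<le> c\<^sub>1 * (?s / \<delta>)" using c\<^sub>1(2)[OF j m] s by (rule mult_right_mono)
    finally have "R < c\<^sub>1 * (?s / \<delta>)" using far v_eq[OF j m] by (simp add: deviation_def)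
    then have "(noise v + 1) * ?T / 2 / \<delta> < ?s / \<delta>" using c\<^sub>1(1) unfolding R_def by (simp only: mult_less_cancel_left_pos)
    then have "(noise v + 1) * ?T / 2 < ?s" using \<delta>(1) by (auto simp only: divide_less_cancel)
    then have "noise v + 1 < 2 / ?T * ?s" using T by (simp add: field_simps)
    then show ?thesis using potential_drift[OF v, of n x] by simp
  qed
  then have "\<forall>n x. x \<notin> shape_within C R \<longrightarrow> next_potential v n x + 1 \<le> potential v n x"
    unfolding shape_within_def by (auto simp: not_le)
  then show ?thesis ..
qed

end

section \<open>Foster's criterion for chains with constant exit rate\<close>

text \<open>
  The chain in jump chain form, for a constant exit rate \<open>L\<close> and jump probabilities \<open>p\<close>. States and holding times
  are kept together since \<open>law\<close> only speaks of paths along which the holding times exceed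
  given bounds; that they are positive almost surely is a consequence.
\<close>

locale jump_chain = prob_space M for M :: "'w measure" +
  fixes p :: "'s::countable \<Rightarrow> 's \<Rightarrow> real" and L :: real
    and Y :: "nat \<Rightarrow> 'w \<Rightarrow> 's" and H :: "nat \<Rightarrow> 'w \<Rightarrow> real" and x\<^sub>0 :: 's
  assumes Y_measurable [measurable]: "Y n \<in> measurable M (count_space UNIV)"
    and H_measurable [measurable]: "H n \<in> borel_measurable M"
    and law: "(\<And>k. 0 \<le> t k) \<Longrightarrow>
      measure M {\<omega> \<in> space M. (\<forall>k\<le>n. Y k \<omega> = y k) \<and> (\<forall>k<n. t k < H k \<omega>)} =
        (if y 0 = x\<^sub>0 then 1 else 0) * (\<Prod>k<n. p (y k) (y (Suc k)) * exp (- L * t k))"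
    and p_nonneg: "0 \<le> p a b"
    and p_stochastic: "(\<integral>\<^sup>+b. ennreal (p a b) \<partial>count_space UNIV) = 1"
begin

lemma nn_integral_discrete:
  fixes Z :: "'w \<Rightarrow> 'c::countable"
  assumes Z [measurable]: "Z \<in> measurable M (count_space UNIV)" and A [measurable]: "A \<in> sets M"
  shows "(\<integral>\<^sup>+\<omega>. G (Z \<omega>) * indicator A \<omega> \<partial>M) =
    (\<integral>\<^sup>+z. G z * emeasure M {\<omega> \<in> space M. Z \<omega> = z \<and> \<omega> \<in> A} \<partial>count_space UNIV)"
proof -
  have m: "{\<omega> \<in> space M. Z \<omega> = z \<and> \<omega> \<in> A} \<in> sets M" for z by measurable
  have "(\<integral>\<^sup>+\<omega>. G (Z \<omega>) * indicator A \<omega> \<partial>M) =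
      (\<integral>\<^sup>+\<omega>. (\<integral>\<^sup>+z. G z * indicator {\<omega> \<in> space M. Z \<omega> = z \<and> \<omega> \<in> A} \<omega> \<partial>count_space UNIV) \<partial>M)"
  proof (rule nn_integral_cong)
    fix \<omega> assume \<omega>: "\<omega> \<in> space M"
    have "(\<integral>\<^sup>+z. G z * indicator {\<omega> \<in> space M. Z \<omega> = z \<and> \<omega> \<in> A} \<omega> \<partial>count_space UNIV) =
        (\<Sum>z\<in>{Z \<omega>}. G z * indicator {\<omega> \<in> space M. Z \<omega> = z \<and> \<omega> \<in> A} \<omega>)"
      by (rule nn_integral_count_space') auto
    then show "G (Z \<omega>) * indicator A \<omega> =
        (\<integral>\<^sup>+z. G z * indicator {\<omega> \<in> space M. Z \<omega> = z \<and> \<omega> \<in> A} \<omega> \<partial>count_space UNIV)"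
      using \<omega> by (simp add: indicator_def)
  qed
  also have "\<dots> = (\<integral>\<^sup>+z. (\<integral>\<^sup>+\<omega>. G z * indicator {\<omega> \<in> space M. Z \<omega> = z \<and> \<omega> \<in> A} \<omega> \<partial>M) \<partial>count_space UNIV)"
    using m by (intro nn_integral_count_space_nn_integral borel_measurable_times_ennreal borel_measurable_indicator borel_measurable_const) auto
  also have "\<dots> = (\<integral>\<^sup>+z. G z * emeasure M {\<omega> \<in> space M. Z \<omega> = z \<and> \<omega> \<in> A} \<partial>count_space UNIV)"
    using m by (intro nn_integral_cong nn_integral_cmult_indicator)
  finally show ?thesis .
qed

definition history :: "nat \<Rightarrow> 'w \<Rightarrow> 's list" where
  "history n \<omega> = map (\<lambda>k. Y k \<omega>) [0..<Suc n]"

definition long_stays :: "nat \<Rightarrow> (nat \<Rightarrow> real) \<Rightarrow> 'w set" where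
  "long_stays n t = {\<omega> \<in> space M. \<forall>k<n. t k < H k \<omega>}"

lemma history_eq_iff: "history n \<omega> = l \<longleftrightarrow> length l = Suc n \<and> (\<forall>k\<le>n. Y k \<omega> = l ! k)"
  unfolding history_def by (auto simp: list_eq_iff_nth_eq less_Suc_eq_le simp del: upt_Suc)

lemma history_nth: "k \<le> n \<Longrightarrow> history n \<omega> ! k = Y k \<omega>"
  unfolding history_def by (simp add: less_Suc_eq_le del: upt_Suc)

lemma history_last: "last (history n \<omega>) = Y n \<omega>"
  unfolding history_def by simp

lemma history_measurable [measurable]: "history n \<in> measurable M (count_space UNIV)"
proof (rule measurable_count_space_eq2_countable[THEN iffD2], intro conjI ballI)
  fix l :: "'s list"
  have "history n -` {l} \<inter> space M = {\<omega> \<in> space M. length l = Suc n \<and> (\<forall>k\<le>n. Y k \<omega> = l ! k)}"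
    by (simp add: set_eq_iff history_eq_iff conj_ac)
  also have "\<dots> \<in> sets M" by measurable
  finally show "history n -` {l} \<inter> space M \<in> sets M" .
qed auto

lemma long_stays_measurable [measurable]: "long_stays n t \<in> sets M"
  unfolding long_stays_def by measurable

lemma history_law_Suc:
  assumes t: "\<And>k. 0 \<le> t k"
  shows "emeasure M {\<omega> \<in> space M. (history n \<omega>, Y (Suc n) \<omega>) = (l, y) \<and> \<omega> \<in> long_stays (Suc n) t} =
    ennreal (p (last l) y) * ennreal (exp (- L * t n)) *
      emeasure M {\<omega> \<in> space M. history n \<omega> = l \<and> \<omega> \<in> long_stays n t}"
proof (cases "length l = Suc n")
  case False
  then have "{\<omega> \<in> space M. (history n \<omega>, Y (Suc n) \<omega>) = (l, y) \<and> \<omega> \<in> long_stays (Suc n) t} = {}"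
    "{\<omega> \<in> space M. history n \<omega> = l \<and> \<omega> \<in> long_stays n t} = {}"
    by (auto simp: history_eq_iff)
  then show ?thesis by (simp only: emeasure_empty mult_zero_right)
next
  case True
  let ?l = "l @ [y]"
  have last: "last l = l ! n" using True by (simp add: last_conv_nth flip: length_0_conv)
  have 1: "{\<omega> \<in> space M. history n \<omega> = l \<and> \<omega> \<in> long_stays n t} =
      {\<omega> \<in> space M. (\<forall>k\<le>n. Y k \<omega> = l ! k) \<and> (\<forall>k<n. t k < H k \<omega>)}"
    using True by (auto simp: history_eq_iff long_stays_def)
  have 2: "{\<omega> \<in> space M. (history n \<omega>, Y (Suc n) \<omega>) = (l, y) \<and> \<omega> \<in> long_stays (Suc n) t} =
      {\<omega> \<in> space M. (\<forall>k\<le>Suc n. Y k \<omega> = ?l ! k) \<and> (\<forall>k<Suc n. t k < H k \<omega>)}"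
    using True by (auto simp: history_eq_iff long_stays_def nth_append le_Suc_eq)
  have "(\<Prod>k<Suc n. p (?l ! k) (?l ! Suc k) * exp (- L * t k)) =
      (\<Prod>k<n. p (l ! k) (l ! Suc k) * exp (- L * t k)) * (p (l ! n) y * exp (- L * t n))"
    using True by (simp add: nth_append)
  moreover have "?l ! 0 = l ! 0" using True by (simp add: nth_append)
  ultimately have "measure M {\<omega> \<in> space M. (\<forall>k\<le>Suc n. Y k \<omega> = ?l ! k) \<and> (\<forall>k<Suc n. t k < H k \<omega>)} =
      p (l ! n) y * exp (- L * t n) *
        measure M {\<omega> \<in> space M. (\<forall>k\<le>n. Y k \<omega> = l ! k) \<and> (\<forall>k<n. t k < H k \<omega>)}"
    unfolding law[OF t] by (simp only: mult_ac)
  then show ?thesis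
    unfolding 1 2 emeasure_eq_measure last
    by (simp only: p_nonneg ennreal_mult[symmetric] exp_ge_zero mult_nonneg_nonneg measure_nonneg)
qed

text \<open>
  The Markov property at time \<open>n\<close>, on the event that the first holding times exceed \<open>t\<close>: the next
  state is drawn from \<open>p\<close>, and the next holding time contributes its own exponential factor.
\<close>

lemma one_step:
  assumes t: "\<And>k. 0 \<le> t k"
  shows "(\<integral>\<^sup>+\<omega>. F (history n \<omega>) (Y (Suc n) \<omega>) * indicator (long_stays (Suc n) t) \<omega> \<partial>M) =
    ennreal (exp (- L * t n)) *
      (\<integral>\<^sup>+\<omega>. (\<integral>\<^sup>+y. ennreal (p (Y n \<omega>) y) * F (history n \<omega>) y \<partial>count_space UNIV) *
        indicator (long_stays n t) \<omega> \<partial>M)"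
proof -
  let ?e = "ennreal (exp (- L * t n))"
  have "(\<lambda>\<omega>. (history n \<omega>, Y (Suc n) \<omega>)) = (\<lambda>\<omega>. (\<lambda>l. (butlast l, last l)) (history (Suc n) \<omega>))"
    by (simp add: history_def fun_eq_iff butlast_append)
  then have pair: "(\<lambda>\<omega>. (history n \<omega>, Y (Suc n) \<omega>)) \<in> measurable M (count_space UNIV)"
    using measurable_compose[OF history_measurable measurable_count_space] by simp
  let ?P = "\<lambda>l. emeasure M {\<omega> \<in> space M. history n \<omega> = l \<and> \<omega> \<in> long_stays n t}"
  have "(\<integral>\<^sup>+\<omega>. F (history n \<omega>) (Y (Suc n) \<omega>) * indicator (long_stays (Suc n) t) \<omega> \<partial>M) =
      (\<integral>\<^sup>+\<omega>. (\<lambda>(l, y). F l y) (history n \<omega>, Y (Suc n) \<omega>) * indicator (long_stays (Suc n) t) \<omega> \<partial>M)"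
    by simp
  also have "\<dots> = (\<integral>\<^sup>+z. (\<lambda>(l, y). F l y) z *
      emeasure M {\<omega> \<in> space M. (history n \<omega>, Y (Suc n) \<omega>) = z \<and> \<omega> \<in> long_stays (Suc n) t} \<partial>count_space UNIV)"
    by (rule nn_integral_discrete[OF pair]) simp
  also have "\<dots> = (\<integral>\<^sup>+l. \<integral>\<^sup>+y. F l y * (ennreal (p (last l) y) * ?e * ?P l) \<partial>count_space UNIV \<partial>count_space UNIV)"
    by (subst nn_integral_fst_count_space[symmetric]) (simp add: history_law_Suc[OF t, simplified])
  also have "\<dots> = (\<integral>\<^sup>+l. ?e * ((\<integral>\<^sup>+y. ennreal (p (last l) y) * F l y \<partial>count_space UNIV) * ?P l) \<partial>count_space UNIV)"
  proof (rule nn_integral_cong)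
    fix l
    have "(\<integral>\<^sup>+y. F l y * (ennreal (p (last l) y) * ?e * ?P l) \<partial>count_space UNIV) =
        (\<integral>\<^sup>+y. (?e * ?P l) * (ennreal (p (last l) y) * F l y) \<partial>count_space UNIV)"
      by (simp only: mult_ac)
    also have "\<dots> = (?e * ?P l) * (\<integral>\<^sup>+y. ennreal (p (last l) y) * F l y \<partial>count_space UNIV)"
      by (rule nn_integral_cmult) simp
    finally show "(\<integral>\<^sup>+y. F l y * (ennreal (p (last l) y) * ?e * ?P l) \<partial>count_space UNIV) =
        ?e * ((\<integral>\<^sup>+y. ennreal (p (last l) y) * F l y \<partial>count_space UNIV) * ?P l)"
      by (simp only: mult_ac)
  qed
  also have "\<dots> = ?e * (\<integral>\<^sup>+l. (\<integral>\<^sup>+y. ennreal (p (last l) y) * F l y \<partial>count_space UNIV) * ?P l \<partial>count_space UNIV)"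
    by (rule nn_integral_cmult) simp
  also have "(\<integral>\<^sup>+l. (\<integral>\<^sup>+y. ennreal (p (last l) y) * F l y \<partial>count_space UNIV) * ?P l \<partial>count_space UNIV) =
      (\<integral>\<^sup>+\<omega>. (\<integral>\<^sup>+y. ennreal (p (last (history n \<omega>)) y) * F (history n \<omega>) y \<partial>count_space UNIV) *
        indicator (long_stays n t) \<omega> \<partial>M)"
    by (rule nn_integral_discrete[OF history_measurable long_stays_measurable, symmetric])
  finally show ?thesis by (simp only: history_last)
qed

lemma prob_long_stays:
  assumes t: "\<And>k. 0 \<le> t k"
  shows "prob (long_stays n t) = (\<Prod>k<n. exp (- L * t k))"
proof (induction n)
  case 0
  then show ?case by (simp add: long_stays_def prob_space)
next
  case (Suc n)
  have "ennreal (prob (long_stays (Suc n) t)) = ennreal (exp (- L * t n)) * ennreal (prob (long_stays n t))"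
    using one_step[OF t, where n = n and F = "\<lambda>_ _. 1"] by (simp add: p_stochastic emeasure_eq_measure)
  also have "\<dots> = ennreal (exp (- L * t n) * prob (long_stays n t))"
    by (simp add: ennreal_mult)
  finally have "prob (long_stays (Suc n) t) = exp (- L * t n) * prob (long_stays n t)"
    by simp
  then show ?case using Suc by simp
qed

lemma AE_H_pos: "AE \<omega> in M. \<forall>k. 0 < H k \<omega>"
proof (subst AE_all_countable, rule allI)
  fix k
  have "AE \<omega> in M. \<omega> \<in> long_stays (Suc k) (\<lambda>_. 0)"
    by (intro AE_prob_1) (simp add: prob_long_stays)
  then show "AE \<omega> in M. 0 < H k \<omega>"
    by eventually_elim (simp add: long_stays_def)
qed

lemma one_step':
  "(\<integral>\<^sup>+\<omega>. F (history n \<omega>) (Y (Suc n) \<omega>) \<partial>M) =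
    (\<integral>\<^sup>+\<omega>. (\<integral>\<^sup>+y. ennreal (p (Y n \<omega>) y) * F (history n \<omega>) y \<partial>count_space UNIV) \<partial>M)"
proof -
  have ae: "AE \<omega> in M. \<omega> \<in> long_stays m (\<lambda>_. 0)" for m
    using AE_H_pos AE_space by eventually_elim (simp add: long_stays_def)
  have "(\<integral>\<^sup>+\<omega>. f \<omega> * indicator (long_stays m (\<lambda>_. 0)) \<omega> \<partial>M) = (\<integral>\<^sup>+\<omega>. f \<omega> \<partial>M)" for f m
    by (rule nn_integral_cong_AE, rule eventually_mono[OF ae[of m]]) simp
  then show ?thesis using one_step[of "\<lambda>_. 0" F n] by simp
qed

text \<open>
  Holding times that need not be long are bounded below by \<open>0\<close>, which almost surely is no restriction.
\<close>

lemma indep_long_stays: "indep_events (\<lambda>k. {\<omega> \<in> space M. 1 < H k \<omega>}) UNIV"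
proof -
  have prod: "prob (\<Inter>k\<in>J. {\<omega> \<in> space M. 1 < H k \<omega>}) = exp (- L) ^ card J"
    if J: "finite J" "J \<noteq> {}" for J
  proof -
    define t :: "nat \<Rightarrow> real" where "t k = (if k \<in> J then 1 else 0)" for k
    define n where "n = Suc (Max J)"
    have Jn: "J \<subseteq> {..<n}" using J by (auto simp: n_def less_Suc_eq_le)
    have "AE \<omega> in M. \<omega> \<in> (\<Inter>k\<in>J. {\<omega> \<in> space M. 1 < H k \<omega>}) \<longleftrightarrow> \<omega> \<in> long_stays n t"
      using AE_H_pos AE_space
    proof eventually_elim
      case (elim \<omega>)
      then show ?case using Jn J(2) by (auto simp: long_stays_def t_def split: if_splits)
    qed
    then have "prob (\<Inter>k\<in>J. {\<omega> \<in> space M. 1 < H k \<omega>}) = prob (long_stays n t)"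
      using J by (intro finite_measure_eq_AE) auto
    also have "\<dots> = (\<Prod>k<n. exp (- L * t k))" by (rule prob_long_stays) (simp add: t_def)
    also have "\<dots> = (\<Prod>k\<in>J. exp (- L))"
      using Jn by (intro prod.mono_neutral_cong_right) (auto simp: t_def)
    finally show ?thesis by simp
  qed
  show ?thesis
    unfolding indep_events_def using prod prod[of "{_}"] by auto
qed

text \<open>
  By the 0-1 law the event has probability 0 or 1, and it is the limit of events of
  probability at least \<open>exp (- L)\<close>. It implies that the jump times tend to infinity.
\<close>

lemma AE_infinitely_many_long_stays: "AE \<omega> in M. infinite {k. 1 < H k \<omega>}"
proof -
  have "\<not> (AE \<omega> in M. finite {k. 1 < H k \<omega>})"
  proof
    assume fin: "AE \<omega> in M. finite {k. 1 < H k \<omega>}"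
    define U where "U n = {\<omega> \<in> space M. \<exists>k\<ge>n. 1 < H k \<omega>}" for n :: nat
    have U [measurable]: "U n \<in> sets M" for n unfolding U_def by measurable
    have "(\<lambda>n. prob (U n)) \<longlonglongrightarrow> prob (\<Inter>n. U n)"
      by (intro finite_Lim_measure_decseq) (auto simp: decseq_def U_def intro: order_trans)
    moreover have "AE \<omega> in M. \<omega> \<notin> (\<Inter>n. U n)"
      using fin
    proof eventually_elim
      case (elim \<omega>)
      then obtain n where "\<forall>k\<in>{k. 1 < H k \<omega>}. k < n" using finite_nat_set_iff_bounded by auto
      then have "\<omega> \<notin> U n" by (auto simp: U_def)
      then show ?case by blast
    qed
    then have "prob (\<Inter>n. U n) = 0" by (subst prob_eq_0) auto
    ultimately have lim: "(\<lambda>n. prob (U n)) \<longlonglongrightarrow> 0" by simp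
    have "exp (- L) \<le> prob (U n)" for n
    proof -
      let ?t = "\<lambda>k. if k = n then 1 else 0"
      have "(\<Prod>k<Suc n. exp (- L * ?t k)) = exp (- L)" by simp
      then have "exp (- L) = prob (long_stays (Suc n) ?t)" by (subst prob_long_stays) auto
      also have "\<dots> \<le> prob (U n)" by (intro finite_measure_mono) (auto simp: long_stays_def U_def)
      finally show ?thesis .
    qed
    then have "exp (- L) \<le> 0" using lim by (intro LIMSEQ_le_const[OF lim]) auto
    then show False by simp
  qed
  then show ?thesis using borel_0_1_law_AE[OF indep_long_stays] by blast
qed

text \<open>
  On paths that have avoided \<open>G\<close> since time \<open>N\<close>, the mean of \<open>\<Phi>\<close> loses in each step at least the probability
  \<open>c\<close> of avoiding \<open>G\<close> forever. It starts from a finite value and stays non-negative, hence \<open>c = 0\<close>.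
\<close>

theorem foster:
  fixes \<Phi> :: "nat \<Rightarrow> 's \<Rightarrow> real" and b :: real
  assumes drift: "\<And>n x. (\<integral>\<^sup>+y. ennreal (p x y) * ennreal (\<Phi> (Suc n) y) \<partial>count_space UNIV) \<le> ennreal (\<Phi> n x) + ennreal b"
    and strict_drift: "\<And>n x. x \<notin> G \<Longrightarrow>
      (\<integral>\<^sup>+y. ennreal (p x y) * ennreal (\<Phi> (Suc n) y) \<partial>count_space UNIV) + 1 \<le> ennreal (\<Phi> n x)"
  shows "AE \<omega> in M. \<forall>N. \<exists>n\<ge>N. Y n \<omega> \<in> G"
proof (subst AE_all_countable, rule allI)
  fix N
  let ?p\<Phi> = "\<lambda>n x. \<integral>\<^sup>+y. ennreal (p x y) * ennreal (\<Phi> (Suc n) y) \<partial>count_space UNIV"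
  have finite_mean: "(\<integral>\<^sup>+\<omega>. ennreal (\<Phi> n (Y n \<omega>)) \<partial>M) < \<top>" for n
  proof (induction n)
    case 0
    have "prob {\<omega> \<in> space M. Y 0 \<omega> = x\<^sub>0} = 1" using law[of "\<lambda>_. 0" 0 "\<lambda>_. x\<^sub>0"] by simp
    then have "AE \<omega> in M. \<omega> \<in> {\<omega> \<in> space M. Y 0 \<omega> = x\<^sub>0}" by (rule AE_prob_1)
    then have "(\<integral>\<^sup>+\<omega>. ennreal (\<Phi> 0 (Y 0 \<omega>)) \<partial>M) = (\<integral>\<^sup>+\<omega>. ennreal (\<Phi> 0 x\<^sub>0) \<partial>M)"
      by (intro nn_integral_cong_AE) (auto elim!: eventually_mono)
    then show ?case by (simp add: emeasure_space_1)
  next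
    case (Suc n)
    have "(\<integral>\<^sup>+\<omega>. ennreal (\<Phi> (Suc n) (Y (Suc n) \<omega>)) \<partial>M) = (\<integral>\<^sup>+\<omega>. ?p\<Phi> n (Y n \<omega>) \<partial>M)"
      using one_step'[of "\<lambda>_ y. ennreal (\<Phi> (Suc n) y)" n] by simp
    also have "\<dots> \<le> (\<integral>\<^sup>+\<omega>. ennreal (\<Phi> n (Y n \<omega>)) + ennreal b \<partial>M)"
      by (intro nn_integral_mono drift)
    also have "\<dots> = (\<integral>\<^sup>+\<omega>. ennreal (\<Phi> n (Y n \<omega>)) \<partial>M) + ennreal b"
      by (subst nn_integral_add) (auto simp: emeasure_space_1)
    also have "\<dots> < \<top>" using Suc by (simp add: less_top)
    finally show ?case .
  qed
  \<comment> \<open>indicator of the event that \<open>G\<close> is avoided at the times \<open>N, \<dots>, m - 1\<close>\<close>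
  define avoid where "avoid m \<omega> = (of_bool (\<forall>k\<in>{N..<m}. Y k \<omega> \<notin> G) :: ennreal)" for m \<omega>
  have [measurable]: "avoid m \<in> borel_measurable M" for m unfolding avoid_def by measurable
  define e where "e m = (\<integral>\<^sup>+\<omega>. ennreal (\<Phi> m (Y m \<omega>)) * avoid m \<omega> \<partial>M)" for m
  define c where "c = emeasure M {\<omega> \<in> space M. \<forall>n\<ge>N. Y n \<omega> \<notin> G}"
  have c_le: "c \<le> (\<integral>\<^sup>+\<omega>. avoid m \<omega> \<partial>M)" for m
  proof -
    have "c = (\<integral>\<^sup>+\<omega>. indicator {\<omega> \<in> space M. \<forall>n\<ge>N. Y n \<omega> \<notin> G} \<omega> \<partial>M)"
      unfolding c_def by (subst nn_integral_indicator) auto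
    also have "\<dots> \<le> (\<integral>\<^sup>+\<omega>. avoid m \<omega> \<partial>M)"
      by (intro nn_integral_mono) (auto simp: avoid_def split: split_indicator)
    finally show ?thesis .
  qed
  have descent: "e (Suc m) + c \<le> e m" if "N \<le> m" for m
  proof -
    let ?F = "\<lambda>l y. ennreal (\<Phi> (Suc m) y) * of_bool (\<forall>k\<in>{N..<Suc m}. l ! k \<notin> G)"
    have hist: "of_bool (\<forall>k\<in>{N..<Suc m}. history m \<omega> ! k \<notin> G) = avoid (Suc m) \<omega>" for \<omega>
      unfolding avoid_def by (simp add: history_nth less_Suc_eq_le)
    have "e (Suc m) = (\<integral>\<^sup>+\<omega>. ?F (history m \<omega>) (Y (Suc m) \<omega>) \<partial>M)"
      unfolding e_def hist ..
    also have "\<dots> = (\<integral>\<^sup>+\<omega>. (\<integral>\<^sup>+y. ennreal (p (Y m \<omega>) y) * ?F (history m \<omega>) y \<partial>count_space UNIV) \<partial>M)"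
      by (rule one_step'[of ?F m])
    also have "\<dots> = (\<integral>\<^sup>+\<omega>. ?p\<Phi> m (Y m \<omega>) * avoid (Suc m) \<omega> \<partial>M)"
      unfolding hist mult.assoc[symmetric] by (intro nn_integral_cong nn_integral_multc) simp
    finally have "e (Suc m) + c \<le> (\<integral>\<^sup>+\<omega>. ?p\<Phi> m (Y m \<omega>) * avoid (Suc m) \<omega> \<partial>M) + (\<integral>\<^sup>+\<omega>. avoid (Suc m) \<omega> \<partial>M)"
      using c_le[of "Suc m"] by (simp add: add_left_mono)
    also have "\<dots> = (\<integral>\<^sup>+\<omega>. ?p\<Phi> m (Y m \<omega>) * avoid (Suc m) \<omega> + avoid (Suc m) \<omega> \<partial>M)"
      by (rule nn_integral_add[symmetric]) auto
    also have "\<dots> \<le> e m"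
      unfolding e_def
    proof (rule nn_integral_mono)
      fix \<omega>
      show "?p\<Phi> m (Y m \<omega>) * avoid (Suc m) \<omega> + avoid (Suc m) \<omega> \<le> ennreal (\<Phi> m (Y m \<omega>)) * avoid m \<omega>"
      proof (cases "\<forall>k\<in>{N..<Suc m}. Y k \<omega> \<notin> G")
        case True
        then have "avoid (Suc m) \<omega> = 1" "avoid m \<omega> = 1" "Y m \<omega> \<notin> G"
          using that by (auto simp: avoid_def)
        then show ?thesis using strict_drift[of "Y m \<omega>" m] by simp
      next
        case False
        then have "avoid (Suc m) \<omega> = 0" by (simp add: avoid_def)
        then show ?thesis by simp
      qed
    qed
    finally show ?thesis .
  qed
  have sum: "e (N + r) + of_nat r * c \<le> e N" for r
  proof (induction r)
    case (Suc r)
    have "e (N + Suc r) + of_nat (Suc r) * c = (e (Suc (N + r)) + c) + of_nat r * c"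
      by (simp add: distrib_right add_ac)
    also have "\<dots> \<le> e (N + r) + of_nat r * c" by (intro add_right_mono descent) simp
    finally show ?case using Suc by simp
  qed simp
  have "e N \<le> (\<integral>\<^sup>+\<omega>. ennreal (\<Phi> N (Y N \<omega>)) \<partial>M)"
    unfolding e_def by (intro nn_integral_mono) (auto simp: avoid_def)
  then have eN: "e N < \<top>" using finite_mean[of N] by (rule le_less_trans)
  have "c = 0"
  proof -
    obtain c' where c': "c = ennreal c'" "0 \<le> c'" unfolding c_def by (metis emeasure_eq_measure measure_nonneg)
    obtain E where E: "e N = ennreal E" "0 \<le> E" using eN by (cases "e N") auto
    have "real r * c' \<le> E" for r
    proof -
      have "of_nat r * c \<le> e (N + r) + of_nat r * c" by simp
      also have "\<dots> \<le> e N" by (rule sum)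
      finally have "ennreal (real r) * ennreal c' \<le> ennreal E"
        using c' E by (simp add: ennreal_of_nat_eq_real_of_nat)
      then show ?thesis using c' E by (simp add: ennreal_mult[symmetric])
    qed
    then have "c' \<le> 0" using reals_Archimedean3[of c'] by (meson not_less)
    then show ?thesis using c' by simp
  qed
  then have "AE \<omega> in M. \<omega> \<notin> {\<omega> \<in> space M. \<forall>n\<ge>N. Y n \<omega> \<notin> G}"
    unfolding c_def by (intro AE_not_in) (auto simp: null_sets_def)
  then show "AE \<omega> in M. \<exists>n\<ge>N. Y n \<omega> \<in> G"
    using AE_space by eventually_elim auto
qed

text \<open>
  The jump times exceed the number of earlier holding times that are longer than \<open>1\<close>.
\<close>

corollary AE_visits_at_late_times:
  assumes "AE \<omega> in M. \<forall>N. \<exists>n\<ge>N. Y n \<omega> \<in> G"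
  shows "AE \<omega> in M. \<forall>T. \<exists>n. T \<le> (\<Sum>k<n. H k \<omega>) \<and> 0 < H n \<omega> \<and> Y n \<omega> \<in> G"
  using assms AE_H_pos AE_infinitely_many_long_stays
proof eventually_elim
  case (elim \<omega>)
  show ?case
  proof
    fix T
    obtain r :: nat where r: "T \<le> real r" using real_arch_simple by blast
    obtain A where A: "A \<subseteq> {k. 1 < H k \<omega>}" "finite A" "card A = r"
      using infinite_arbitrarily_large[OF elim(3)] by blast
    obtain N where N: "A \<subseteq> {..<N}" using A(2) finite_nat_set_iff_bounded by auto
    obtain n where n: "n \<ge> N" "Y n \<omega> \<in> G" using elim(1) by blast
    have "real r = (\<Sum>k\<in>A. 1)" using A by simp
    also have "\<dots> \<le> (\<Sum>k\<in>A. H k \<omega>)" using A(1) by (intro sum_mono) auto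
    also have "\<dots> \<le> (\<Sum>k<n. H k \<omega>)"
      using N n elim(2) by (intro sum_mono2) (auto intro: less_imp_le)
    finally show "\<exists>n. T \<le> (\<Sum>k<n. H k \<omega>) \<and> 0 < H n \<omega> \<and> Y n \<omega> \<in> G"
      using r n elim(2) by force
  qed
qed

lemma AE_visits_continuous_time:
  assumes visits: "AE \<omega> in M. \<forall>N. \<exists>n\<ge>N. Y n \<omega> \<in> G"
    and X: "AE \<omega> in M. \<forall>n t. (\<Sum>k<n. H k \<omega>) \<le> t \<and> t < (\<Sum>k<Suc n. H k \<omega>) \<longrightarrow> X t \<omega> = Y n \<omega>"
  shows "AE \<omega> in M. \<forall>T. \<exists>t\<ge>T. X t \<omega> \<in> G"
  using AE_visits_at_late_times[OF visits] X
proof eventually_elim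
  case (elim \<omega>)
  show ?case
  proof
    fix T
    obtain n where n: "T \<le> (\<Sum>k<n. H k \<omega>)" "0 < H n \<omega>" "Y n \<omega> \<in> G" using elim(1) by blast
    then have "X (\<Sum>k<n. H k \<omega>) \<omega> = Y n \<omega>" using elim(2) by simp
    then show "\<exists>t\<ge>T. X t \<omega> \<in> G" using n by metis
  qed
qed

end

section \<open>Recurrence in shape\<close>

lemma (in network) jlw_jump_chain:
  assumes "markov_chain_from rate M X x\<^sub>0"
  obtains Y H where "jump_chain M jump_prob total_rate Y H x\<^sub>0"
    "AE \<omega> in M. \<forall>n t. (\<Sum>k<n. H k \<omega>) \<le> t \<and> t < (\<Sum>k<Suc n. H k \<omega>) \<longrightarrow> X t \<omega> = Y n \<omega>"
proof -
  obtain Y H where Y: "\<forall>n. Y n \<in> measurable M (count_space UNIV)" and H: "\<forall>n. H n \<in> borel_measurable M"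
    and law: "\<forall>(n::nat) y t. (\<forall>k. 0 \<le> t k) \<longrightarrow>
           measure M {\<omega> \<in> space M. (\<forall>k\<le>n. Y k \<omega> = y k) \<and> (\<forall>k<n. t k < H k \<omega>)} =
             (if y 0 = x\<^sub>0 then 1 else 0) *
             (\<Prod>k<n. rate (y k) (y (Suc k)) / exit_rate rate (y k) * exp (- exit_rate rate (y k) * t k))"
    and X: "AE \<omega> in M. \<forall>n t. (\<Sum>k<n. H k \<omega>) \<le> t \<and> t < (\<Sum>k<Suc n. H k \<omega>) \<longrightarrow> X t \<omega> = Y n \<omega>"
    using assms unfolding markov_chain_from_def by blast
  interpret prob_space M using assms unfolding markov_chain_from_def by blast
  have "jump_chain M jump_prob total_rate Y H x\<^sub>0"
  proof
    show "Y n \<in> measurable M (count_space UNIV)" for n using Y by blast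
    show "H n \<in> borel_measurable M" for n using H by blast
    show "measure M {\<omega> \<in> space M. (\<forall>k\<le>n. Y k \<omega> = y k) \<and> (\<forall>k<n. t k < H k \<omega>)} =
        (if y 0 = x\<^sub>0 then 1 else 0) * (\<Prod>k<n. jump_prob (y k) (y (Suc k)) * exp (- total_rate * t k))"
      if "\<And>k. 0 \<le> t k" for n y t
      using law that unfolding exit_rate_jlw jump_prob_def by blast
    show "0 \<le> jump_prob a b" for a b by (rule jump_prob_nonneg)
    show "(\<integral>\<^sup>+b. ennreal (jump_prob a b) \<partial>count_space UNIV) = 1" for a by (rule jump_prob_stochastic)
  qed
  then show thesis using that X by blast
qed

theorem theorem5:
  fixes S :: "'i::finite \<Rightarrow> 'n::finite set"
    and lam :: "'i \<Rightarrow> real"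
    and mu w :: "'n \<Rightarrow> real"
    and P :: "int ^ 'n \<Rightarrow> 'w measure"
    and \<xi> :: "real \<Rightarrow> 'w \<Rightarrow> int ^ 'n"
    and k :: nat and C :: "'n set"
  assumes "\<And>i. S i \<noteq> {}"
    and "\<And>i. lam i \<ge> 0"
    and "\<And>j. mu j > 0"
    and "connected_network S lam"
    and "\<And>j. w j > 0"
    and "\<And>x. markov_chain_from (jlw_rate S lam mu w) (P x) \<xi> x"
    and "1 \<le> k" and "k \<le> num_stages S lam mu w"
    and "bonded S lam mu w k C"
  shows "recurrent_in_shape P (weighted w \<xi>) C"
proof -
  interpret network S lam mu w using assms(1,3,5) by unfold_locales
  obtain \<pi> v where ad: "adapted \<pi> v" and conn: "\<forall>j\<in>C. \<forall>m\<in>C. (Inr j, Inr m) \<in> (graph \<pi>)\<^sup>*"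
    using bonded_adapted_policy[OF assms(7-9)] .
  obtain R where R: "\<And>n x. x \<notin> shape_within C R \<Longrightarrow> next_potential v n x + 1 \<le> potential v n x"
    using potential_strict_drift[OF ad conn] by blast
  have visits: "AE \<omega> in P x. \<forall>T. \<exists>t\<ge>T. \<xi> t \<omega> \<in> shape_within C R" for x
  proof -
    obtain Y H where YH: "jump_chain (P x) jump_prob total_rate Y H x"
      "AE \<omega> in P x. \<forall>n t. (\<Sum>k<n. H k \<omega>) \<le> t \<and> t < (\<Sum>k<Suc n. H k \<omega>) \<longrightarrow> \<xi> t \<omega> = Y n \<omega>"
      using jlw_jump_chain[OF assms(6)] .
    interpret jump_chain "P x" jump_prob total_rate Y H x by (rule YH(1))
    have "AE \<omega> in P x. \<forall>N. \<exists>n\<ge>N. Y n \<omega> \<in> shape_within C R"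
    proof (rule foster)
      fix n y
      show "(\<integral>\<^sup>+z. ennreal (jump_prob y z) * ennreal (potential v (Suc n) z) \<partial>count_space UNIV) \<le>
          ennreal (potential v n y) + ennreal (noise v)"
        unfolding nn_integral_next_potential ennreal_plus[OF potential_nonneg noise_nonneg, symmetric]
        by (rule ennreal_leI) (rule potential_weak_drift[OF ad])
      show "(\<integral>\<^sup>+z. ennreal (jump_prob y z) * ennreal (potential v (Suc n) z) \<partial>count_space UNIV) + 1 \<le>
          ennreal (potential v n y)" if "y \<notin> shape_within C R"
        unfolding nn_integral_next_potential ennreal_1[symmetric]
          ennreal_plus[OF next_potential_nonneg zero_le_one, symmetric]
        by (rule ennreal_leI) (rule R[OF that])
    qed
    then show ?thesis using YH(2) by (rule AE_visits_continuous_time)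
  qed
  show ?thesis
    unfolding recurrent_in_shape_def recurrent_def
  proof (intro ballI exI conjI allI)
    fix j\<^sub>0 assume j\<^sub>0: "j\<^sub>0 \<in> C"
    let ?B = "cbox (\<chi> j. - \<bar>R\<bar>) (\<chi> j. \<bar>R\<bar>) :: (real ^ 'n) set"
    show "bounded ?B" by (rule bounded_cbox)
    fix x
    have "(\<chi> j. if j \<in> C then weighted w \<xi> t \<omega> $ j - weighted w \<xi> t \<omega> $ j\<^sub>0 else 0) \<in> ?B"
      if "\<xi> t \<omega> \<in> shape_within C R" for t \<omega>
      using that j\<^sub>0 by (fastforce simp: shape_within_def mem_box_cart weighted_def abs_le_iff)
    then show "AE \<omega> in P x. \<forall>T. \<exists>t\<ge>T.
        (\<chi> j. if j \<in> C then weighted w \<xi> t \<omega> $ j - weighted w \<xi> t \<omega> $ j\<^sub>0 else 0) \<in> ?B"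
      using visits[of x] by (elim eventually_mono) blast
  qed
qed

end
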